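(* Let $\mathcal M$ be a von Neumann algebra with identity $\mathbf 1$, let $\mathcal M_1$ denote its closed unit ball, and let $x\in\mathcal M_1$. Then $x$ is a $C^*$-extreme point of $\mathcal M_1$ if and only if there exist central projections $p_1,p_2,p_3\in\mathcal M$ such that $p_1+p_2+p_3=\mathbf 1$ and the following hold: (i) either $p_1=0$, or $p_1x$ is a unitary in $p_1\mathcal M$; (ii) either $p_2=0$, or $p_2x$ is a non-unitary isometry in $p_2\mathcal M$; and (iii) either $p_3=0$, or $p_3x$ is a non-unitary coisometry in $p_3\mathcal M$.
   Context: For a unital $C^*$-algebra $\mathcal A$ with identity $\mathbf 1$ and closed unit ball $\mathcal A_1$, an element $x\in\mathcal A_1$ is a $C^*$-extreme point of $\mathcal A_1$ if, whenever $x=\sum_{i=1}^k t_i^*x_it_i$ with $x_1,\dots,x_k\in\mathcal A_1$ and $t_1,\dots,t_k\in\mathcal A$ invertible with $\sum_{i=1}^k t_i^*t_i=\mathbf 1$, there exist unitaries $u_1,\dots,u_k\in\mathcal A$ such that $x_i=u_i^*xu_i$ for $i=1,\dots,k$. An isometry is an element $v$ with $v^*v$ equal to the identity; a coisometry is an element $v$ with $vv^*$ equal to the identity. For a central projection $p\in\mathcal M$, $p\mathcal M$ is regarded as a von Neumann algebra with identity $p$. *)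

theory Defs
  imports "HOL-Analysis.Analysis"
begin

(* A complex Hilbert space is presented on top of its underlying real Hilbert space: the real inner
   product is the real part of the complex one, so the norm of the class real_inner is the usual
   Hilbert space norm, since cinner x x is real. *)

class complex_inner_space = real_inner +
  fixes scaleC :: "complex \<Rightarrow> 'a \<Rightarrow> 'a"  (infixr \<open>*\<^sub>C\<close> 75)
    and cinner :: "'a \<Rightarrow> 'a \<Rightarrow> complex"
  assumes scaleC_add_right: "c *\<^sub>C (x + y) = c *\<^sub>C x + c *\<^sub>C y"
    and scaleC_add_left: "(c + d) *\<^sub>C x = c *\<^sub>C x + d *\<^sub>C x"
    and scaleC_scaleC: "c *\<^sub>C (d *\<^sub>C x) = (c * d) *\<^sub>C x"
    and scaleC_of_real: "complex_of_real r *\<^sub>C x = scaleR r x"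
    and cinner_commute: "cinner x y = cnj (cinner y x)"
    and cinner_add_left: "cinner (x + y) z = cinner x z + cinner y z"
    and cinner_scaleC_left: "cinner (c *\<^sub>C x) y = c * cinner x y"
    and Re_cinner: "Re (cinner x y) = inner x y"

class complex_hilbert_space = complex_inner_space + complete_space

(* The library type of bounded operators consists of the real-linear ones, with the operator norm;
   B(H) is the set of those that commute with complex scalars. *)

definition bounded_operators :: "('h::complex_hilbert_space \<Rightarrow>\<^sub>L 'h) set"
  where "bounded_operators = {T. \<forall>c x. blinfun_apply T (c *\<^sub>C x) = c *\<^sub>C blinfun_apply T x}"

definition scale_op :: "complex \<Rightarrow> ('h::complex_hilbert_space \<Rightarrow>\<^sub>L 'h) \<Rightarrow> ('h \<Rightarrow>\<^sub>L 'h)"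
  where "scale_op c T = Blinfun (\<lambda>x. c *\<^sub>C blinfun_apply T x)"

(* The adjoint exists and is unique for every T in B(H); it is only used for such T. *)

definition adj :: "('h::complex_hilbert_space \<Rightarrow>\<^sub>L 'h) \<Rightarrow> ('h \<Rightarrow>\<^sub>L 'h)"
  where "adj T = (THE S. \<forall>x y. cinner (blinfun_apply T x) y = cinner x (blinfun_apply S y))"

definition star_subalgebra :: "('h::complex_hilbert_space \<Rightarrow>\<^sub>L 'h) set \<Rightarrow> bool"
  where "star_subalgebra A \<longleftrightarrow> A \<subseteq> bounded_operators \<and> 0 \<in> A \<and>
    (\<forall>S\<in>A. \<forall>T\<in>A. S + T \<in> A) \<and> (\<forall>c. \<forall>T\<in>A. scale_op c T \<in> A) \<and>
    (\<forall>S\<in>A. \<forall>T\<in>A. S o\<^sub>L T \<in> A) \<and> (\<forall>T\<in>A. adj T \<in> A)"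

definition commutant :: "('h::complex_hilbert_space \<Rightarrow>\<^sub>L 'h) set \<Rightarrow> ('h \<Rightarrow>\<^sub>L 'h) set"
  where "commutant A = {T \<in> bounded_operators. \<forall>S\<in>A. T o\<^sub>L S = S o\<^sub>L T}"

(* The definition of Dixmier and Takesaki: a star-subalgebra of B(H) equal to its bicommutant.
   In particular it contains the identity operator of H. *)

definition von_neumann_algebra :: "('h::complex_hilbert_space \<Rightarrow>\<^sub>L 'h) set \<Rightarrow> bool"
  where "von_neumann_algebra M \<longleftrightarrow> star_subalgebra M \<and> commutant (commutant M) = M"

definition unit_ball :: "('h::complex_hilbert_space \<Rightarrow>\<^sub>L 'h) set \<Rightarrow> ('h \<Rightarrow>\<^sub>L 'h) set"
  where "unit_ball A = {T \<in> A. norm T \<le> 1}"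

(* The following notions are relative to an algebra A of operators with identity element e, which
   need not be the identity operator of H: this is needed for corners p M. *)

definition invertible_in :: "('h::complex_hilbert_space \<Rightarrow>\<^sub>L 'h) set \<Rightarrow> ('h \<Rightarrow>\<^sub>L 'h) \<Rightarrow> ('h \<Rightarrow>\<^sub>L 'h) \<Rightarrow> bool"
  where "invertible_in A e t \<longleftrightarrow> t \<in> A \<and> (\<exists>s\<in>A. s o\<^sub>L t = e \<and> t o\<^sub>L s = e)"

definition isometry_in :: "('h::complex_hilbert_space \<Rightarrow>\<^sub>L 'h) set \<Rightarrow> ('h \<Rightarrow>\<^sub>L 'h) \<Rightarrow> ('h \<Rightarrow>\<^sub>L 'h) \<Rightarrow> bool"
  where "isometry_in A e v \<longleftrightarrow> v \<in> A \<and> adj v o\<^sub>L v = e"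

definition coisometry_in :: "('h::complex_hilbert_space \<Rightarrow>\<^sub>L 'h) set \<Rightarrow> ('h \<Rightarrow>\<^sub>L 'h) \<Rightarrow> ('h \<Rightarrow>\<^sub>L 'h) \<Rightarrow> bool"
  where "coisometry_in A e v \<longleftrightarrow> v \<in> A \<and> v o\<^sub>L adj v = e"

definition unitary_in :: "('h::complex_hilbert_space \<Rightarrow>\<^sub>L 'h) set \<Rightarrow> ('h \<Rightarrow>\<^sub>L 'h) \<Rightarrow> ('h \<Rightarrow>\<^sub>L 'h) \<Rightarrow> bool"
  where "unitary_in A e u \<longleftrightarrow> u \<in> A \<and> adj u o\<^sub>L u = e \<and> u o\<^sub>L adj u = e"

definition central_projection :: "('h::complex_hilbert_space \<Rightarrow>\<^sub>L 'h) set \<Rightarrow> ('h \<Rightarrow>\<^sub>L 'h) \<Rightarrow> bool"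
  where "central_projection M p \<longleftrightarrow>
    p \<in> M \<and> adj p = p \<and> p o\<^sub>L p = p \<and> (\<forall>y\<in>M. p o\<^sub>L y = y o\<^sub>L p)"

definition corner :: "('h::complex_hilbert_space \<Rightarrow>\<^sub>L 'h) \<Rightarrow> ('h \<Rightarrow>\<^sub>L 'h) set \<Rightarrow> ('h \<Rightarrow>\<^sub>L 'h) set"
  where "corner p M = (\<lambda>y. p o\<^sub>L y) ` M"

(* Here A is meant to be a C*-algebra of operators containing the identity operator of H. *)

definition cstar_extreme_point :: "('h::complex_hilbert_space \<Rightarrow>\<^sub>L 'h) set \<Rightarrow> ('h \<Rightarrow>\<^sub>L 'h) \<Rightarrow> bool"
  where "cstar_extreme_point A x \<longleftrightarrow> x \<in> unit_ball A \<and>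
    (\<forall>(k::nat) (y::nat \<Rightarrow> 'h \<Rightarrow>\<^sub>L 'h) (t::nat \<Rightarrow> 'h \<Rightarrow>\<^sub>L 'h).
      (\<forall>i\<in>{1..k}. y i \<in> unit_ball A) \<and>
      (\<forall>i\<in>{1..k}. invertible_in A id_blinfun (t i)) \<and>
      (\<Sum>i\<in>{1..k}. adj (t i) o\<^sub>L t i) = id_blinfun \<and>
      x = (\<Sum>i\<in>{1..k}. adj (t i) o\<^sub>L y i o\<^sub>L t i)
      \<longrightarrow> (\<exists>u::nat \<Rightarrow> 'h \<Rightarrow>\<^sub>L 'h. \<forall>i\<in>{1..k}.
            unitary_in A id_blinfun (u i) \<and> y i = (adj (u i) o\<^sub>L x o\<^sub>L u i)))"

end

theory Submission
  imports Defs
begin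

text \<open>Let $x$ be extreme. Convex combinations with scalar weights show that every summand of a midpoint
  decomposition of $x$ is unitarily equivalent to $x$. Cutting $|x|$ by a spectral projection writes $x$ as
  the midpoint of a partial isometry and a contraction, so $x$ is a partial isometry. If
  $a \in (1 - xx^*) M (1 - x^*x)$ has norm less than 1, then $x$ is the midpoint of the contractions
  $x \pm a$, so $x + a$ is a partial isometry as well, which forces $a = aa^*a$ and hence $a = 0$. Thus
  $1 - x^*x$ and $1 - xx^*$ are separated by a central projection.

  Conversely, cutting by central projections and passing to adjoints reduces to an isometry
  $x = \sum_i t_i^* x_i t_i$. Equality in the norm estimate gives $t_i x = x_i t_i$ with $x_i$
  isometric, so $x$ and $x_i$ are similar isometries. By the Wold decomposition the similarity can be
  replaced by an invertible operator of $M$ that intertwines the adjoints too, and the unitary part of its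
  polar decomposition conjugates $x$ into $x_i$.\<close>

text \<open>If an invertible t satisfies t x = y t, its unitary part conjugates x into y exactly
  when t also intertwines the adjoints, that is, when \<open>adj t o\<^sub>L t\<close> commutes with
  x. For normal elements this is automatic (Fuglede-Putnam). For isometries it can fail: t maps the
  range of x onto the range of y but may tilt the orthogonal complement. The inverse adjoint of t
  does carry the kernel of \<open>adj x\<close> onto that of \<open>adj y\<close>, which is why it
  takes the place of t on the shift part. The resulting series converge strongly and in general not
  in norm, so the algebra enters through its bicommutant: commutation passes to strong limits.
  Inequalities between functions of |x| are obtained from positivity of polynomials in |x|, and a
  corner is completed by the complementary central projection, so that every construction stays
  inside M.\<close>

lemma blinfun_compose_assoc: "(A o\<^sub>L B) o\<^sub>L C = A o\<^sub>L (B o\<^sub>L C)"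
  by (rule blinfun_eqI) simp

lemma id_blinfun_compose [simp]: "id_blinfun o\<^sub>L A = A" "A o\<^sub>L id_blinfun = A"
  by (rule blinfun_eqI, simp)+

lemma blinfun_compose_zero_left [simp]: "0 o\<^sub>L A = 0"
  by (rule blinfun_eqI) simp

lemmas blinfun_compose_bilinear =
  bounded_bilinear.add_left[OF bounded_bilinear_blinfun_compose]
  bounded_bilinear.add_right[OF bounded_bilinear_blinfun_compose]
  bounded_bilinear.diff_left[OF bounded_bilinear_blinfun_compose]
  bounded_bilinear.diff_right[OF bounded_bilinear_blinfun_compose]
  bounded_bilinear.minus_left[OF bounded_bilinear_blinfun_compose]
  bounded_bilinear.minus_right[OF bounded_bilinear_blinfun_compose]
  bounded_bilinear.scaleR_left[OF bounded_bilinear_blinfun_compose]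
  bounded_bilinear.scaleR_right[OF bounded_bilinear_blinfun_compose]

lemmas op_simps = blinfun_compose_assoc blinfun_compose_bilinear

text \<open>\<open>op_simps\<close> nests compositions to the right, where a rule for
  \<open>A o\<^sub>L B\<close> does not match the head of a longer product. This form does.\<close>

lemma blinfun_compose_extend: "A o\<^sub>L B = C \<Longrightarrow> A o\<^sub>L (B o\<^sub>L D) = C o\<^sub>L D"
  by (simp flip: blinfun_compose_assoc)

lemma norm_blinfun_le_1D: "norm (T :: 'a::real_normed_vector \<Rightarrow>\<^sub>L 'b::real_normed_vector) \<le> 1 \<Longrightarrow> norm (blinfun_apply T v) \<le> norm v"
  using norm_blinfun[of T v] mult_right_mono[of "norm T" 1 "norm v"] by simp

section \<open>Complex inner products and adjoints\<close>

text \<open>Conjugate linearity in the second argument recovers the imaginary part from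
  \<open>inner\<close>. Adjoints can therefore be constructed and compared with the real inner
  product alone.\<close>

lemma cinner_eq_inner:
  "cinner (x :: 'a::complex_inner_space) y = Complex (inner x y) (inner x (\<i> *\<^sub>C y))"
proof -
  have "cinner x (\<i> *\<^sub>C y) = cnj (\<i> * cinner y x)"
    by (metis cinner_commute cinner_scaleC_left)
  also have "\<dots> = - \<i> * cinner x y"
    by (simp add: cinner_commute[of x y])
  finally have "Re (cinner x (\<i> *\<^sub>C y)) = Im (cinner x y)"
    by simp
  then show ?thesis
    by (simp add: complex_eq_iff Re_cinner)
qed

lemma inner_scaleC_left:
  "inner (c *\<^sub>C x) y = inner (x :: 'a::complex_inner_space) (cnj c *\<^sub>C y)"
proof -
  have "cinner x (cnj c *\<^sub>C y) = cinner (c *\<^sub>C x) y"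
    by (metis cinner_commute cinner_scaleC_left complex_cnj_cnj complex_cnj_mult)
  then show ?thesis
    by (metis Re_cinner)
qed

lemma scaleC_diff_right: "c *\<^sub>C (x - y) = c *\<^sub>C x - c *\<^sub>C (y :: 'a::complex_inner_space)"
  by (metis add_diff_cancel_right' diff_add_cancel scaleC_add_right)

lemma norm_scaleC: "norm (c *\<^sub>C x) = cmod c * norm (x :: 'a::complex_inner_space)"
proof -
  have "(norm (c *\<^sub>C x))\<^sup>2 = inner x ((cnj c * c) *\<^sub>C x)"
    by (simp add: power2_norm_eq_inner inner_scaleC_left scaleC_scaleC)
  also have "cnj c * c = complex_of_real ((cmod c)\<^sup>2)"
    by (metis complex_norm_square mult.commute of_real_power)
  finally have "(norm (c *\<^sub>C x))\<^sup>2 = (cmod c * norm x)\<^sup>2"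
    by (simp add: scaleC_of_real power2_norm_eq_inner power_mult_distrib)
  then show ?thesis
    by simp
qed

lemma bounded_linear_scaleC: "bounded_linear (\<lambda>x :: 'a::complex_inner_space. c *\<^sub>C x)"
proof (rule bounded_linear_intro[where K = "cmod c"])
  show "c *\<^sub>C (r *\<^sub>R x) = r *\<^sub>R (c *\<^sub>C x)" for r and x :: 'a
    by (metis scaleC_of_real scaleC_scaleC mult.commute)
qed (auto simp: scaleC_add_right norm_scaleC mult.commute)

text \<open>The functional |w|^2 - 2 f w is minimised over S, and the minimiser represents f because
  the first variation vanishes. With S the whole space this yields adjoints; with f the inner
  product with u it yields the orthogonal projection of u.\<close>

lemma ex_riesz_representer:
  fixes f :: "'a::{real_inner,complete_space} \<Rightarrow> real"
  assumes S: "closed S" "subspace S" and f: "bounded_linear f"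
  shows "\<exists>v\<in>S. \<forall>w\<in>S. inner v w = f w"
proof -
  interpret f: bounded_linear f by fact
  define J where "J w = (norm w)\<^sup>2 - 2 * f w" for w
  obtain K where K: "\<And>w. norm (f w) \<le> norm w * K"
    using f.bounded by blast
  have J_ge: "J w \<ge> - K\<^sup>2" for w
  proof -
    have "0 \<le> (norm w - K)\<^sup>2" by simp
    then show ?thesis
      using K[of w] by (simp add: J_def power2_eq_square algebra_simps)
  qed
  \<comment> \<open>Parallelogram law. The linear part of \<open>J\<close> cancels, so almost
    minimal points are close together.\<close>
  have par: "(norm (u - w))\<^sup>2 = 2 * (J u + J w - 2 * J ((1/2) *\<^sub>R (u + w)))" for u w
    by (simp add: J_def f.add f.scaleR power2_norm_eq_inner inner_add inner_diff inner_commute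
        algebra_simps)
  define m where "m = Inf (J ` S)"
  have bdd: "bdd_below (J ` S)"
    using J_ge by (intro bdd_belowI[of _ "- K\<^sup>2"]) auto
  have ne: "J ` S \<noteq> {}"
    using S(2) subspace_0 by blast
  have m_le: "m \<le> J w" if "w \<in> S" for w
    unfolding m_def using that bdd by (intro cInf_lower) auto
  have "\<exists>w\<in>S. J w < m + 1 / (real n + 1)" for n
    using cInf_lessD[OF ne, of "m + 1 / (real n + 1)"] by (auto simp: m_def)
  then obtain w where w: "\<And>n. w n \<in> S" "\<And>n. J (w n) < m + 1 / (real n + 1)"
    by metis
  have est: "(norm (w i - w j))\<^sup>2 \<le> 4 / (real N + 1)" if "N \<le> i" "N \<le> j" for i j N
  proof -
    have "(1/2) *\<^sub>R (w i + w j) \<in> S"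
      using S(2) w(1) by (simp add: subspace_add subspace_scale)
    moreover have "1 / (real i + 1) \<le> 1 / (real N + 1)" "1 / (real j + 1) \<le> 1 / (real N + 1)"
      using that by (auto intro!: divide_left_mono)
    ultimately show ?thesis
      using par[of "w i" "w j"] w(2)[of i] w(2)[of j] m_le[of "(1/2) *\<^sub>R (w i + w j)"] by auto
  qed
  have "Cauchy w"
  proof (rule metric_CauchyI)
    fix e :: real assume "0 < e"
    obtain N :: nat where N: "real N > 4 / e\<^sup>2"
      using reals_Archimedean2 by blast
    have "norm (w i - w j) < e" if "N \<le> i" "N \<le> j" for i j
    proof -
      have "4 < e\<^sup>2 * real N"
        using N \<open>0 < e\<close> by (simp add: pos_divide_less_eq mult.commute)
      then have "4 < e\<^sup>2 * (real N + 1)"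
        using \<open>0 < e\<close> by (smt (verit, best) mult_left_mono zero_le_power2)
      then have "4 / (real N + 1) < e\<^sup>2"
        by (simp add: pos_divide_less_eq)
      then have "(norm (w i - w j))\<^sup>2 < e\<^sup>2"
        using est[OF that] by linarith
      then show ?thesis
        using \<open>0 < e\<close> power_less_imp_less_base less_imp_le by blast
    qed
    then show "\<exists>M. \<forall>m\<ge>M. \<forall>n\<ge>M. dist (w m) (w n) < e"
      by (auto simp: dist_norm)
  qed
  then obtain v where v: "w \<longlonglongrightarrow> v"
    using Cauchy_convergent convergent_def by blast
  have "v \<in> S"
    using S(1) w(1) v closed_sequentially by blast
  have "(\<lambda>n. J (w n)) \<longlonglongrightarrow> J v"
    unfolding J_def using v by (intro tendsto_intros f.tendsto)
  moreover have "(\<lambda>n. m + 1 / (real n + 1)) \<longlonglongrightarrow> m + 0"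
    using LIMSEQ_inverse_real_of_nat by (intro tendsto_intros) (simp add: inverse_eq_divide add.commute)
  ultimately have "J v \<le> m"
    using w(2) by (intro LIMSEQ_le[of "\<lambda>n. J (w n)" "J v" "\<lambda>n. m + 1 / (real n + 1)" m])
      (auto intro: less_imp_le)
  have "inner v u = f u" if u: "u \<in> S" for u
  proof (rule ccontr)
    assume neq: "inner v u \<noteq> f u"
    define d where "d = inner v u - f u"
    have u0: "inner u u > 0"
      using neq f.zero by (metis inner_gt_zero_iff inner_zero_right)
    \<comment> \<open>Minimiser of the quadratic 2 t d + t^2 |u|^2; its negative minimum contradicts
      the minimality of v.\<close>
    define t where "t = - d / inner u u"
    have "v + t *\<^sub>R u \<in> S"
      using S(2) u \<open>v \<in> S\<close> by (simp add: subspace_add subspace_scale)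
    then have "J v \<le> J (v + t *\<^sub>R u)"
      using m_le \<open>J v \<le> m\<close> by fastforce
    also have "J (v + t *\<^sub>R u) = J v + 2 * t * d + t * t * inner u u"
      by (simp add: J_def d_def f.add f.scaleR power2_norm_eq_inner inner_add inner_commute
          algebra_simps)
    also have "\<dots> = J v - d\<^sup>2 / inner u u"
      using u0 by (simp add: t_def field_simps power2_eq_square)
    finally have "d\<^sup>2 / inner u u \<le> 0" by simp
    moreover have "d\<^sup>2 / inner u u > 0"
      using u0 neq by (simp add: d_def)
    ultimately show False by simp
  qed
  with \<open>v \<in> S\<close> show ?thesis by blast
qed

lemma inner_eqI: "(\<And>z. inner x z = inner y z) \<Longrightarrow> x = (y :: 'a::real_inner)"
  by (metis inner_eq_zero_iff inner_diff_left right_minus_eq)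

lemma bounded_operatorsD:
  "T \<in> bounded_operators \<Longrightarrow> blinfun_apply T (c *\<^sub>C x) = c *\<^sub>C blinfun_apply T x"
  by (simp add: bounded_operators_def)

text \<open>Moving a scalar through T shows that its real adjoint is complex-linear. Then
  \<open>cinner_eq_inner\<close> upgrades the identity to \<open>cinner\<close>, and nondegeneracy
  identifies the \<open>THE\<close> in \<open>adj\<close>.\<close>

lemma adj_eqI:
  fixes T S :: "'h::complex_hilbert_space \<Rightarrow>\<^sub>L 'h"
  assumes T: "T \<in> bounded_operators"
    and TS: "\<And>x y. inner (blinfun_apply T x) y = inner x (blinfun_apply S y)"
  shows "adj T = S" "S \<in> bounded_operators"
proof -
  show S: "S \<in> bounded_operators"
    unfolding bounded_operators_def
  proof (safe, rule inner_eqI)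
    fix c x z
    have "inner (blinfun_apply S (c *\<^sub>C x)) z = inner (c *\<^sub>C x) (blinfun_apply T z)"
      by (metis TS inner_commute)
    also have "\<dots> = inner x (blinfun_apply T (cnj c *\<^sub>C z))"
      by (simp add: inner_scaleC_left bounded_operatorsD[OF T])
    also have "\<dots> = inner (blinfun_apply S x) (cnj c *\<^sub>C z)"
      by (metis TS inner_commute)
    finally show "inner (blinfun_apply S (c *\<^sub>C x)) z = inner (c *\<^sub>C blinfun_apply S x) z"
      by (simp add: inner_scaleC_left)
  qed
  have eq: "cinner (blinfun_apply T x) y = cinner x (blinfun_apply S y)" for x y
    by (simp add: cinner_eq_inner TS bounded_operatorsD[OF S])
  show "adj T = S"
    unfolding adj_def
  proof (rule the_equality)
    fix S' assume S': "\<forall>x y. cinner (blinfun_apply T x) y = cinner x (blinfun_apply S' y)"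
    show "S' = S"
    proof (rule blinfun_eqI, rule inner_eqI)
      fix x z
      show "inner (blinfun_apply S' x) z = inner (blinfun_apply S x) z"
        using S' eq by (metis Re_cinner inner_commute)
    qed
  qed (use eq in blast)
qed

lemma ex_real_adjoint:
  fixes T :: "'h::{real_inner,complete_space} \<Rightarrow>\<^sub>L 'h"
  shows "\<exists>S. \<forall>x y. inner (blinfun_apply T x) y = inner x (blinfun_apply S y)"
proof -
  have "\<exists>v. \<forall>w. inner v w = inner (blinfun_apply T w) y" for y
    using ex_riesz_representer[of UNIV "\<lambda>w. inner (blinfun_apply T w) y"]
    by (simp add: bounded_linear_compose[OF bounded_linear_inner_left blinfun.bounded_linear_right])
  then obtain g where g: "\<And>y w. inner (g y) w = inner (blinfun_apply T w) y"
    by metis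
  have "bounded_linear g"
  proof (rule bounded_linear_intro[where K = "norm T"])
    show "g (x + y) = g x + g y" for x y
      by (rule inner_eqI) (simp add: g inner_add)
    show "g (r *\<^sub>R x) = r *\<^sub>R g x" for r x
      by (rule inner_eqI) (simp add: g)
    show "norm (g x) \<le> norm x * norm T" for x
    proof -
      have "(norm (g x))\<^sup>2 \<le> norm (blinfun_apply T (g x)) * norm x"
        using g[of x "g x"] norm_cauchy_schwarz[of "blinfun_apply T (g x)" x]
        by (simp add: power2_norm_eq_inner)
      also have "\<dots> \<le> (norm T * norm (g x)) * norm x"
        by (intro mult_right_mono norm_blinfun) simp
      finally show ?thesis
        by (cases "g x = 0") (auto simp: power2_eq_square mult_ac)
    qed
  qed
  then have "blinfun_apply (Blinfun g) = g"
    by (rule bounded_linear_Blinfun_apply)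
  then have "\<forall>x y. inner (blinfun_apply T x) y = inner x (blinfun_apply (Blinfun g) y)"
    using g by (metis inner_commute)
  then show ?thesis by blast
qed

lemma inner_adj_right:
  fixes T :: "'h::complex_hilbert_space \<Rightarrow>\<^sub>L 'h"
  assumes "T \<in> bounded_operators"
  shows "inner x (blinfun_apply (adj T) y) = inner (blinfun_apply T x) y"
proof -
  obtain S where S: "\<And>x y. inner (blinfun_apply T x) y = inner x (blinfun_apply S y)"
    using ex_real_adjoint by blast
  then have "adj T = S"
    by (rule adj_eqI(1)[OF assms])
  then show ?thesis
    by (simp add: S)
qed

lemma inner_adj_left:
  fixes T :: "'h::complex_hilbert_space \<Rightarrow>\<^sub>L 'h"
  assumes "T \<in> bounded_operators"
  shows "inner (blinfun_apply (adj T) x) y = inner x (blinfun_apply T y)"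
  using inner_adj_right[OF assms, of y x] by (simp add: inner_commute)

lemma adj_in_bounded_operators:
  fixes T :: "'h::complex_hilbert_space \<Rightarrow>\<^sub>L 'h"
  assumes "T \<in> bounded_operators"
  shows "adj T \<in> bounded_operators"
  by (rule adj_eqI(2)[OF assms]) (simp add: inner_adj_right[OF assms])

lemma id_in_bounded_operators [simp]: "id_blinfun \<in> bounded_operators"
  by (simp add: bounded_operators_def)

lemma bounded_operators_scaleR [simp]:
  fixes T :: "'h::complex_hilbert_space \<Rightarrow>\<^sub>L 'h"
  assumes "T \<in> bounded_operators"
  shows "r *\<^sub>R T \<in> bounded_operators"
proof -
  have "r *\<^sub>R c *\<^sub>C x = c *\<^sub>C r *\<^sub>R x" for c and x :: 'h
    by (metis scaleC_of_real scaleC_scaleC mult.commute)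
  then show ?thesis
    using assms by (simp add: bounded_operators_def blinfun.bilinear_simps)
qed

lemma bounded_operators_closed [simp]:
  fixes S T :: "'h::complex_hilbert_space \<Rightarrow>\<^sub>L 'h"
  assumes "S \<in> bounded_operators" "T \<in> bounded_operators"
  shows "S + T \<in> bounded_operators" "S - T \<in> bounded_operators" "S o\<^sub>L T \<in> bounded_operators"
  using assms by (simp_all add: bounded_operators_def blinfun.bilinear_simps scaleC_add_right
      scaleC_diff_right)

lemma adj_adj:
  fixes T :: "'h::complex_hilbert_space \<Rightarrow>\<^sub>L 'h"
  assumes "T \<in> bounded_operators"
  shows "adj (adj T) = T"
  using assms by (intro adj_eqI(1) adj_in_bounded_operators) (simp_all add: inner_adj_left)

lemma adj_scaleR:
  fixes T :: "'h::complex_hilbert_space \<Rightarrow>\<^sub>L 'h"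
  assumes "T \<in> bounded_operators"
  shows "adj (r *\<^sub>R T) = r *\<^sub>R adj T"
  using assms by (intro adj_eqI(1)) (simp_all add: inner_adj_right blinfun.bilinear_simps)

lemma adj_simps:
  fixes S T :: "'h::complex_hilbert_space \<Rightarrow>\<^sub>L 'h"
  assumes "S \<in> bounded_operators" "T \<in> bounded_operators"
  shows "adj (S + T) = adj S + adj T" "adj (S - T) = adj S - adj T"
    "adj (S o\<^sub>L T) = adj T o\<^sub>L adj S"
  using assms by (intro adj_eqI(1);
      simp add: inner_adj_right blinfun.bilinear_simps inner_add inner_diff)+

lemma adj_id [simp]: "adj (id_blinfun :: 'h::complex_hilbert_space \<Rightarrow>\<^sub>L 'h) = id_blinfun"
  by (rule adj_eqI(1)) simp_all

section \<open>Norms, isometries and orthogonal projections\<close>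

lemma norm_adj_compose:
  fixes T :: "'h::complex_hilbert_space \<Rightarrow>\<^sub>L 'h"
  assumes "T \<in> bounded_operators"
  shows "(norm (blinfun_apply T v))\<^sup>2 = inner v (blinfun_apply (adj T o\<^sub>L T) v)"
  by (simp add: inner_adj_right[OF assms] power2_norm_eq_inner)

lemma norm_adj_le:
  fixes T :: "'h::complex_hilbert_space \<Rightarrow>\<^sub>L 'h"
  assumes T: "T \<in> bounded_operators"
  shows "norm (adj T) \<le> norm T"
proof (rule norm_blinfun_bound)
  fix v
  have "(norm (blinfun_apply (adj T) v))\<^sup>2 = inner (blinfun_apply T (blinfun_apply (adj T) v)) v"
    by (simp add: power2_norm_eq_inner inner_adj_right[OF T])
  also have "\<dots> \<le> norm (blinfun_apply T (blinfun_apply (adj T) v)) * norm v"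
    by (rule norm_cauchy_schwarz)
  also have "\<dots> \<le> norm T * norm (blinfun_apply (adj T) v) * norm v"
    by (intro mult_right_mono norm_blinfun) simp
  finally show "norm (blinfun_apply (adj T) v) \<le> norm T * norm v"
    by (cases "norm (blinfun_apply (adj T) v) = 0") (auto simp: power2_eq_square mult_ac)
qed simp

lemma isometry_norm:
  fixes T :: "'h::complex_hilbert_space \<Rightarrow>\<^sub>L 'h"
  assumes "T \<in> bounded_operators" "adj T o\<^sub>L T = id_blinfun"
  shows "norm (blinfun_apply T v) = norm v"
  using norm_adj_compose[OF assms(1), of v] assms(2)
  by (simp add: norm_eq_sqrt_inner power2_norm_eq_inner)

text \<open>S is only a real subspace here, so P is only real-linear; complex linearity is recovered
  later from commutation with scalars.\<close>

lemma ex_orthogonal_projection: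
  fixes S :: "'h::{real_inner,complete_space} set"
  assumes S: "closed S" "subspace S"
  shows "\<exists>P :: 'h \<Rightarrow>\<^sub>L 'h. (\<forall>v. (blinfun_apply P v = v) = (v \<in> S)) \<and> (\<forall>v. blinfun_apply P v \<in> S) \<and>
    (\<forall>v w. inner (blinfun_apply P v) w = inner v (blinfun_apply P w))"
proof -
  have "\<exists>v\<in>S. \<forall>w\<in>S. inner v w = inner u w" for u
    using ex_riesz_representer[OF S bounded_linear_inner_right[of u]] by blast
  then obtain g where gS: "\<And>u. g u \<in> S" and g: "\<And>u w. w \<in> S \<Longrightarrow> inner (g u) w = inner u w"
    by metis
  have uniq: "g u = v" if "v \<in> S" "\<And>w. w \<in> S \<Longrightarrow> inner v w = inner u w" for u v
  proof -
    have "g u - v \<in> S"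
      using gS that(1) S(2) by (simp add: subspace_diff)
    then have "inner (g u - v) (g u - v) = 0"
      using that(2) g by (metis inner_diff_left right_minus_eq)
    then show ?thesis by simp
  qed
  have "bounded_linear g"
  proof (rule bounded_linear_intro[where K = 1])
    show "g (x + y) = g x + g y" for x y
      by (rule uniq) (simp_all add: gS g S(2) subspace_add inner_add)
    show "g (r *\<^sub>R x) = r *\<^sub>R g x" for r x
      by (rule uniq) (simp_all add: gS g S(2) subspace_scale)
    show "norm (g x) \<le> norm x * 1" for x
    proof -
      have "norm (g x) * norm (g x) \<le> norm x * norm (g x)"
        using g[OF gS, of x x] norm_cauchy_schwarz[of x "g x"]
        by (simp add: power2_norm_eq_inner flip: power2_eq_square)
      then show ?thesis
        by (cases "g x = 0") auto
    qed
  qed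
  then have [simp]: "blinfun_apply (Blinfun g) = g"
    by (rule bounded_linear_Blinfun_apply)
  have fixed: "g v = v" if "v \<in> S" for v
    using uniq that by blast
  have "inner (g v) w = inner v (g w)" for v w
    using g gS by (metis inner_commute)
  moreover have "(g v = v) = (v \<in> S)" for v
    using gS[of v] fixed[of v] by auto
  ultimately show ?thesis
    using gS by (intro exI[of _ "Blinfun g"]) simp
qed

section \<open>Von Neumann algebras\<close>

locale vna =
  fixes M :: "('h::complex_hilbert_space \<Rightarrow>\<^sub>L 'h) set"
  assumes vn: "von_neumann_algebra M"
begin

lemma M_bounded [simp]: "T \<in> M \<Longrightarrow> T \<in> bounded_operators"
  using vn by (auto simp: von_neumann_algebra_def star_subalgebra_def)

lemma M_closed [simp]:
  "S \<in> M \<Longrightarrow> T \<in> M \<Longrightarrow> S + T \<in> M"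
  "S \<in> M \<Longrightarrow> T \<in> M \<Longrightarrow> S o\<^sub>L T \<in> M"
  "T \<in> M \<Longrightarrow> adj T \<in> M"
  "0 \<in> M"
  using vn by (auto simp: von_neumann_algebra_def star_subalgebra_def)

lemma M_scaleR [simp]: "T \<in> M \<Longrightarrow> r *\<^sub>R T \<in> M"
proof -
  assume "T \<in> M"
  then have "scale_op (complex_of_real r) T \<in> M"
    using vn by (auto simp: von_neumann_algebra_def star_subalgebra_def)
  moreover have "bounded_linear (\<lambda>x. r *\<^sub>R blinfun_apply T x)"
    by (intro bounded_linear_intros)
  then have "scale_op (complex_of_real r) T = r *\<^sub>R T"
    by (intro blinfun_eqI) (simp add: scale_op_def scaleC_of_real bounded_linear_Blinfun_apply
        blinfun.bilinear_simps)
  ultimately show ?thesis by simp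
qed

lemma M_diff [simp]: "S \<in> M \<Longrightarrow> T \<in> M \<Longrightarrow> S - T \<in> M"
  using M_closed(1)[of S "(-1) *\<^sub>R T"] M_scaleR[of T "-1"] by simp

text \<open>This is the form in which limits and projections are shown to belong to M: only
  commutation has to be checked.\<close>

lemma M_iff:
  "T \<in> M \<longleftrightarrow> T \<in> bounded_operators \<and> (\<forall>C\<in>commutant M. T o\<^sub>L C = C o\<^sub>L T)"
  using vn by (auto simp: von_neumann_algebra_def commutant_def)

lemma M_id [simp]: "id_blinfun \<in> M"
  by (simp add: M_iff)

lemma M_sum: "(\<And>i. i \<in> I \<Longrightarrow> T i \<in> M) \<Longrightarrow> (\<Sum>i\<in>I. T i) \<in> M"
  by (induction I rule: infinite_finite_induct) auto

lemma adj_M [simp]: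
  "T \<in> M \<Longrightarrow> adj (adj T) = T"
  "S \<in> M \<Longrightarrow> T \<in> M \<Longrightarrow> adj (S + T) = adj S + adj T"
  "S \<in> M \<Longrightarrow> T \<in> M \<Longrightarrow> adj (S - T) = adj S - adj T"
  "S \<in> M \<Longrightarrow> T \<in> M \<Longrightarrow> adj (S o\<^sub>L T) = adj T o\<^sub>L adj S"
  "T \<in> M \<Longrightarrow> adj (r *\<^sub>R T) = r *\<^sub>R adj T"
  by (simp_all add: adj_adj adj_simps adj_scaleR)

lemma commutant_adj:
  assumes "C \<in> commutant M"
  shows "adj C \<in> commutant M"
proof -
  have C: "C \<in> bounded_operators" "\<And>S. S \<in> M \<Longrightarrow> C o\<^sub>L S = S o\<^sub>L C"
    using assms by (auto simp: commutant_def)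
  have "adj C o\<^sub>L S = S o\<^sub>L adj C" if S: "S \<in> M" for S
  proof -
    have "adj (adj S o\<^sub>L C) = adj (C o\<^sub>L adj S)"
      using C(2)[of "adj S"] S by simp
    then show ?thesis
      using S C(1) by (simp add: adj_simps)
  qed
  then show ?thesis
    using C(1) by (simp add: commutant_def adj_in_bounded_operators)
qed

text \<open>The elements of M are complex-linear, so scalars lie in the commutant. Invariance under
  the commutant thus includes invariance under complex scalars.\<close>

lemma commutant_scaleC: "\<exists>C\<in>commutant M. \<forall>v. blinfun_apply C v = c *\<^sub>C v"
proof -
  have *: "blinfun_apply (Blinfun (\<lambda>v. c *\<^sub>C v)) v = c *\<^sub>C v" for v :: 'h
    by (simp add: bounded_linear_Blinfun_apply bounded_linear_scaleC)
  have "Blinfun (\<lambda>v. c *\<^sub>C v) \<in> commutant M"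
    unfolding commutant_def bounded_operators_def
    by (auto simp: * scaleC_scaleC mult.commute bounded_operatorsD intro!: blinfun_eqI)
  with * show ?thesis by blast
qed

lemma strong_limit_commute:
  fixes T :: "nat \<Rightarrow> 'a::real_normed_vector \<Rightarrow>\<^sub>L 'a"
  assumes lim: "\<And>v. (\<lambda>n. blinfun_apply (T n) v) \<longlonglongrightarrow> blinfun_apply L v"
    and C: "\<And>n. T n o\<^sub>L C = C o\<^sub>L T n"
  shows "L o\<^sub>L C = C o\<^sub>L L"
proof (rule blinfun_eqI)
  fix v
  have "(\<lambda>n. blinfun_apply C (blinfun_apply (T n) v)) \<longlonglongrightarrow> blinfun_apply C (blinfun_apply L v)"
    using lim by (rule blinfun.tendsto[OF tendsto_const])
  moreover have "blinfun_apply C (blinfun_apply (T n) v) = blinfun_apply (T n) (blinfun_apply C v)" for n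
    using C[of n] by (metis blinfun_apply_blinfun_compose)
  ultimately show "blinfun_apply (L o\<^sub>L C) v = blinfun_apply (C o\<^sub>L L) v"
    using lim[of "blinfun_apply C v"] LIMSEQ_unique by simp
qed

text \<open>Commutation with the commutant survives strong limits, and the scalars in the commutant
  make L complex-linear.\<close>

lemma strong_limit_in_M:
  assumes T: "\<And>n. T n \<in> M" and lim: "\<And>v. (\<lambda>n. blinfun_apply (T n) v) \<longlonglongrightarrow> blinfun_apply L v"
  shows "L \<in> M"
proof -
  have comm: "L o\<^sub>L C = C o\<^sub>L L" if "C \<in> commutant M" for C
    using T that M_iff by (intro strong_limit_commute[OF lim]) blast
  have "blinfun_apply L (c *\<^sub>C v) = c *\<^sub>C blinfun_apply L v" for c v
  proof -
    obtain C where "C \<in> commutant M" "\<And>v. blinfun_apply C v = c *\<^sub>C v"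
      using commutant_scaleC by blast
    then show ?thesis
      using comm[of C] by (metis blinfun_apply_blinfun_compose)
  qed
  then show ?thesis
    using comm by (simp add: M_iff bounded_operators_def)
qed

text \<open>If T and \<open>adj T\<close> leave S invariant, then P T P = T P, and the adjoint of
  the same relation for \<open>adj T\<close> is P T P = P T; so P commutes with T. The commutant is
  closed under adjoints, so this applies to it and puts P into M. The last clause keeps the
  conclusion for all other T, as central and spectral projections require.\<close>

lemma ex_projection_in_M:
  assumes S: "closed S" "subspace S"
    and inv: "\<And>C v. C \<in> commutant M \<Longrightarrow> v \<in> S \<Longrightarrow> blinfun_apply C v \<in> S"
  shows "\<exists>P\<in>M. adj P = P \<and> P o\<^sub>L P = P \<and> (\<forall>v. (blinfun_apply P v = v) = (v \<in> S)) \<and>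
    (\<forall>T\<in>bounded_operators. (\<forall>v\<in>S. blinfun_apply T v \<in> S \<and> blinfun_apply (adj T) v \<in> S) \<longrightarrow>
      P o\<^sub>L T = T o\<^sub>L P)"
proof -
  obtain P :: "'h \<Rightarrow>\<^sub>L 'h" where P: "\<And>v. (blinfun_apply P v = v) = (v \<in> S)" "\<And>v. blinfun_apply P v \<in> S"
    "\<And>v w. inner (blinfun_apply P v) w = inner v (blinfun_apply P w)"
    using ex_orthogonal_projection[OF S] by metis
  have Pfix: "blinfun_apply P v = v" if "v \<in> S" for v
    using P(1) that by blast
  have comm: "P o\<^sub>L T = T o\<^sub>L P"
    if T: "T \<in> bounded_operators" "\<And>v. v \<in> S \<Longrightarrow> blinfun_apply T v \<in> S" "\<And>v. v \<in> S \<Longrightarrow> blinfun_apply (adj T) v \<in> S"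
    for T
  proof (rule blinfun_eqI, rule inner_eqI)
    fix v w
    have "inner (blinfun_apply P (blinfun_apply T v)) w = inner v (blinfun_apply (adj T) (blinfun_apply P w))"
      by (simp add: P(3) inner_adj_right[OF T(1)])
    also have "\<dots> = inner v (blinfun_apply P (blinfun_apply (adj T) (blinfun_apply P w)))"
      using T(3) P(2) Pfix by simp
    also have "\<dots> = inner (blinfun_apply P (blinfun_apply T (blinfun_apply P v))) w"
      by (simp add: P(3)[symmetric] inner_adj_right[OF T(1)])
    also have "blinfun_apply P (blinfun_apply T (blinfun_apply P v)) = blinfun_apply T (blinfun_apply P v)"
      using T(2) P(2) Pfix by simp
    finally show "inner (blinfun_apply (P o\<^sub>L T) v) w = inner (blinfun_apply (T o\<^sub>L P) v) w"
      by simp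
  qed
  have "blinfun_apply P (c *\<^sub>C v) = c *\<^sub>C blinfun_apply P v" for c v
  proof -
    obtain C where C: "C \<in> commutant M" "\<And>v. blinfun_apply C v = c *\<^sub>C v"
      using commutant_scaleC by blast
    have "C \<in> bounded_operators"
      using C(1) by (simp add: commutant_def)
    then have "P o\<^sub>L C = C o\<^sub>L P"
      using inv C(1) commutant_adj by (intro comm) auto
    then show ?thesis
      using C(2) by (metis blinfun_apply_blinfun_compose)
  qed
  then have bP: "P \<in> bounded_operators"
    by (simp add: bounded_operators_def)
  have "P o\<^sub>L C = C o\<^sub>L P" if "C \<in> commutant M" for C
    using inv that commutant_adj by (intro comm) (auto simp: commutant_def)
  then have "P \<in> M"
    using bP by (simp add: M_iff)
  moreover have "adj P = P"
    by (rule adj_eqI(1)[OF bP P(3)])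
  moreover have "P o\<^sub>L P = P"
    by (rule blinfun_eqI) (simp add: Pfix P(2))
  ultimately show ?thesis
    using P(1) comm by blast
qed

end

section \<open>Square roots, inverses and spectral projections\<close>

instance complex_hilbert_space \<subseteq> banach ..

lemma inverse_commute:
  assumes "R o\<^sub>L T = id_blinfun" "T o\<^sub>L R = id_blinfun" "C o\<^sub>L T = T o\<^sub>L C"
  shows "C o\<^sub>L R = R o\<^sub>L C"
proof -
  have "C o\<^sub>L R = R o\<^sub>L (T o\<^sub>L C) o\<^sub>L R"
    using assms(1) by (simp flip: blinfun_compose_assoc)
  also have "\<dots> = R o\<^sub>L (C o\<^sub>L T) o\<^sub>L R"
    using assms(3) by simp
  also have "\<dots> = R o\<^sub>L C"
    using assms(2) by (simp add: blinfun_compose_assoc)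
  finally show ?thesis .
qed

context vna
begin

text \<open>The square expands to |v|^2 - 2 |T v|^2 plus the squared length of \<open>adj T\<close>
  applied to T v, which is at most |T v|^2.\<close>

lemma norm_id_minus_adj_compose:
  assumes "T \<in> M" "norm T \<le> 1"
  shows "(norm (v - blinfun_apply (adj T) (blinfun_apply T v)))\<^sup>2 \<le> (norm v)\<^sup>2 - (norm (blinfun_apply T v))\<^sup>2"
proof -
  have "norm (adj T) \<le> 1"
    using norm_adj_le[of T] assms by simp
  then have "(norm (blinfun_apply (adj T) (blinfun_apply T v)))\<^sup>2 \<le> (norm (blinfun_apply T v))\<^sup>2"
    by (intro power_mono norm_blinfun_le_1D) auto
  moreover have "inner v (blinfun_apply (adj T) (blinfun_apply T v)) = (norm (blinfun_apply T v))\<^sup>2"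
    using assms(1) by (simp add: inner_adj_right power2_norm_eq_inner)
  ultimately show ?thesis
    unfolding power2_norm_eq_inner by (simp add: inner_diff inner_commute)
qed

text \<open>The iteration $b \mapsto (a + b^2)/2$ with $a = 1 - T^*T$ converges to $1 - |T|$. Its increments
  are dominated by those of the scalar iteration $\beta \mapsto (1 + \beta^2)/2$, which increases and is
  bounded by 1; this gives convergence in norm although $\|a\| = 1$ is allowed.\<close>

lemma ex_absolute_value:
  assumes T: "T \<in> M" "norm T \<le> 1"
  shows "\<exists>s\<in>M. adj s = s \<and> s o\<^sub>L s = adj T o\<^sub>L T \<and> (\<forall>v. inner (blinfun_apply s v) v \<ge> 0) \<and>
    (\<forall>C. C o\<^sub>L (adj T o\<^sub>L T) = (adj T o\<^sub>L T) o\<^sub>L C \<longrightarrow> C o\<^sub>L s = s o\<^sub>L C)"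
proof -
  define a where "a = id_blinfun - (adj T o\<^sub>L T)"
  define b where "b = rec_nat 0 (\<lambda>_ B. (1/2) *\<^sub>R (a + (B o\<^sub>L B)))"
  define \<beta> :: "nat \<Rightarrow> real" where "\<beta> = rec_nat 0 (\<lambda>_ x. (1 + x * x) / 2)"
  have b_rec: "b 0 = 0" "\<And>n. b (Suc n) = (1/2) *\<^sub>R (a + (b n o\<^sub>L b n))"
    by (simp_all add: b_def)
  have \<beta>_rec: "\<beta> 0 = 0" "\<And>n. \<beta> (Suc n) = (1 + \<beta> n * \<beta> n) / 2"
    by (simp_all add: \<beta>_def)
  have a_norm: "norm a \<le> 1"
  proof (rule norm_blinfun_bound)
    fix v
    have "(norm (v - blinfun_apply (adj T) (blinfun_apply T v)))\<^sup>2 \<le> (norm v)\<^sup>2"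
      using norm_id_minus_adj_compose[OF T, of v] by (smt (verit) zero_le_power2)
    then show "norm (blinfun_apply a v) \<le> 1 * norm v"
      by (simp add: a_def blinfun.bilinear_simps)
  qed simp
  have \<beta>01: "0 \<le> \<beta> n \<and> \<beta> n \<le> 1" for n
  proof (induction n)
    case (Suc n)
    then have "\<beta> n * \<beta> n \<le> 1 * 1"
      by (intro mult_mono) auto
    then show ?case by (simp add: \<beta>_rec)
  qed (simp add: \<beta>_rec)
  have \<beta>_mono: "\<beta> n \<le> \<beta> (Suc n)" for n
  proof -
    have "0 \<le> (1 - \<beta> n) * (1 - \<beta> n)" by simp
    then show ?thesis by (simp add: \<beta>_rec algebra_simps)
  qed
  have b_norm: "norm (b n) \<le> \<beta> n" for n
  proof (induction n)
    case (Suc n)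
    have "norm (b n o\<^sub>L b n) \<le> \<beta> n * \<beta> n"
      using norm_blinfun_compose[of "b n" "b n"] mult_mono[OF Suc Suc] \<beta>01[of n] by simp
    then show ?case
      using a_norm norm_triangle_ineq[of a "b n o\<^sub>L b n"] by (simp add: b_rec \<beta>_rec)
  qed (simp add: b_rec \<beta>_rec)
  have diff: "norm (b (n + k) - b n) \<le> \<beta> (n + k) - \<beta> n" for n k
  proof (induction n)
    case 0
    show ?case using b_norm[of k] by (simp add: b_rec \<beta>_rec)
  next
    case (Suc n)
    let ?B = "b (n + k)" and ?C = "b n"
    \<comment> \<open>Written in this order, the factorisation holds for noncommuting
      operators.\<close>
    have "(?B o\<^sub>L ?B) - (?C o\<^sub>L ?C) = (?B o\<^sub>L (?B - ?C)) + ((?B - ?C) o\<^sub>L ?C)"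
      by (simp add: op_simps)
    then have "norm ((?B o\<^sub>L ?B) - (?C o\<^sub>L ?C)) \<le> norm ?B * norm (?B - ?C) + norm (?B - ?C) * norm ?C"
      by (metis norm_triangle_le add_mono norm_blinfun_compose)
    also have "\<dots> \<le> \<beta> (n + k) * (\<beta> (n + k) - \<beta> n) + (\<beta> (n + k) - \<beta> n) * \<beta> n"
      using Suc b_norm \<beta>01 order_trans[OF norm_ge_zero Suc] by (intro add_mono mult_mono) auto
    also have "\<dots> = 2 * (\<beta> (Suc n + k) - \<beta> (Suc n))"
      by (simp add: \<beta>_rec algebra_simps)
    finally have "norm ((?B o\<^sub>L ?B) - (?C o\<^sub>L ?C)) \<le> 2 * (\<beta> (Suc n + k) - \<beta> (Suc n))" .
    moreover have "b (Suc n + k) - b (Suc n) = (1/2) *\<^sub>R ((?B o\<^sub>L ?B) - (?C o\<^sub>L ?C))"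
      by (simp add: b_rec algebra_simps)
    ultimately show ?case by simp
  qed
  have "Bseq \<beta>"
    using \<beta>01 by (intro BseqI'[of _ 1]) simp
  then have "convergent \<beta>"
    using \<beta>_mono by (intro Bseq_monoseq_convergent) (auto simp: monoseq_Suc)
  then have "Cauchy \<beta>" by (rule convergent_Cauchy)
  have "Cauchy b"
  proof (rule metric_CauchyI)
    fix e :: real assume "0 < e"
    then obtain N where N: "\<And>m n. m \<ge> N \<Longrightarrow> n \<ge> N \<Longrightarrow> dist (\<beta> m) (\<beta> n) < e"
      using \<open>Cauchy \<beta>\<close> by (meson metric_CauchyD)
    have lt: "dist (b m) (b n) < e" if "m \<ge> n" "n \<ge> N" for m n
      using diff[of n "m - n"] N[of m n] that by (simp add: dist_norm)
    have "dist (b m) (b n) < e" if "m \<ge> N" "n \<ge> N" for m n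
      using lt[of m n] lt[of n m] that by (cases "m \<ge> n") (auto simp: dist_commute)
    then show "\<exists>M. \<forall>m\<ge>M. \<forall>n\<ge>M. dist (b m) (b n) < e" by blast
  qed
  then obtain B where B: "b \<longlonglongrightarrow> B"
    using Cauchy_convergent convergent_def by blast
  have B_strong: "(\<lambda>n. blinfun_apply (b n) v) \<longlonglongrightarrow> blinfun_apply B v" for v
    using B by (rule blinfun.tendsto) simp
  have "(\<lambda>n. b (Suc n)) \<longlonglongrightarrow> (1/2) *\<^sub>R (a + (B o\<^sub>L B))"
    unfolding b_rec by (intro tendsto_intros bounded_bilinear.tendsto[OF bounded_bilinear_blinfun_compose] B)
  moreover have "(\<lambda>n. b (Suc n)) \<longlonglongrightarrow> B"
    using B by (rule LIMSEQ_Suc)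
  ultimately have "(1/2) *\<^sub>R (a + (B o\<^sub>L B)) = B"
    using LIMSEQ_unique by blast
  \<comment> \<open>Equivalently (1 - B)^2 = 1 - a, and 1 - a is
    \<open>adj T o\<^sub>L T\<close>.\<close>
  then have BB: "B o\<^sub>L B = 2 *\<^sub>R B - a"
    by (metis add_diff_cancel_left' scaleR_half_double scaleR_2 scaleR_right_distrib)
  have aM: "a \<in> M" and a_adj: "adj a = a"
    using T by (simp_all add: a_def)
  have bM: "b n \<in> M \<and> adj (b n) = b n" for n
    by (induction n) (use aM a_adj in \<open>auto simp: b_rec\<close>, metis M_id M_scaleR adj_M(5) scaleR_zero_left)
  have BM: "B \<in> M"
    using bM by (intro strong_limit_in_M[OF _ B_strong]) blast
  have B_adj: "adj B = B"
  proof (rule adj_eqI(1))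
    fix v w
    have "inner (blinfun_apply (b n) v) w = inner v (blinfun_apply (b n) w)" for n
      using bM[of n] by (metis M_bounded inner_adj_right)
    moreover have "(\<lambda>n. inner (blinfun_apply (b n) v) w) \<longlonglongrightarrow> inner (blinfun_apply B v) w"
      "(\<lambda>n. inner v (blinfun_apply (b n) w)) \<longlonglongrightarrow> inner v (blinfun_apply B w)"
      by (intro tendsto_intros B_strong)+
    ultimately show "inner (blinfun_apply B v) w = inner v (blinfun_apply B w)"
      using LIMSEQ_unique by simp
  qed (use BM in simp)
  have B_norm: "norm B \<le> 1"
  proof (rule LIMSEQ_le_const2)
    show "(\<lambda>n. norm (b n)) \<longlonglongrightarrow> norm B"
      using B by (rule tendsto_norm)
    show "\<exists>N. \<forall>n\<ge>N. norm (b n) \<le> 1"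
      using b_norm \<beta>01 order_trans by blast
  qed
  define s where "s = id_blinfun - B"
  have "s \<in> M" "adj s = s"
    using BM B_adj by (simp_all add: s_def)
  moreover have "s o\<^sub>L s = adj T o\<^sub>L T"
    by (simp add: s_def op_simps BB a_def scaleR_2)
  moreover have "inner (blinfun_apply s v) v \<ge> 0" for v
  proof -
    have "inner (blinfun_apply B v) v \<le> norm (blinfun_apply B v) * norm v"
      by (rule norm_cauchy_schwarz)
    also have "\<dots> \<le> norm v * norm v"
      by (intro mult_right_mono norm_blinfun_le_1D B_norm) simp
    finally show ?thesis
      by (simp add: s_def blinfun.bilinear_simps inner_diff power2_norm_eq_inner flip: power2_eq_square)
  qed
  \<comment> \<open>Each iterate is a polynomial in a. Allowing arbitrary C here makes this clause
    do the work of functional calculus later.\<close>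
  moreover have "C o\<^sub>L s = s o\<^sub>L C" if C: "C o\<^sub>L (adj T o\<^sub>L T) = (adj T o\<^sub>L T) o\<^sub>L C" for C
  proof -
    have "b n o\<^sub>L C = C o\<^sub>L b n" for n
    proof (induction n)
      case (Suc n)
      have "a o\<^sub>L C = C o\<^sub>L a"
        using C by (simp add: a_def blinfun_compose_bilinear)
      moreover have "b n o\<^sub>L b n o\<^sub>L C = C o\<^sub>L (b n o\<^sub>L b n)"
        using Suc by (metis blinfun_compose_assoc)
      ultimately show ?case
        by (simp add: b_rec blinfun_compose_bilinear)
    qed (simp add: b_rec)
    then have "B o\<^sub>L C = C o\<^sub>L B"
      by (intro strong_limit_commute[OF B_strong])
    then show ?thesis
      by (simp add: s_def blinfun_compose_bilinear)
  qed
  ultimately show ?thesis by blast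
qed

section \<open>Inverses and spectral projections inside the algebra\<close>

lemma closed_M: "closed M"
  unfolding closed_sequential_limits
proof (intro allI impI, elim conjE)
  fix T L assume T: "\<forall>n. T n \<in> M" and lim: "T \<longlonglongrightarrow> L"
  show "L \<in> M"
  proof (rule strong_limit_in_M[of T])
    show "(\<lambda>n. blinfun_apply (T n) v) \<longlonglongrightarrow> blinfun_apply L v" for v
      using lim by (rule blinfun.tendsto) simp
  qed (use T in blast)
qed

text \<open>T may be indefinite, and then 1 - T can have norm above 1, so the square is inverted.
  With D = 1 - T^2 the lower bound gives |D v|^2 \<le> (1 - c^2) |v|^2. Hence r = 1 + r D is a fixed
  point equation for a contraction of the complete set M, and its solution inverts T^2.\<close>

lemma ex_selfadjoint_inverse:
  assumes T: "T \<in> M" "adj T = T" "norm T \<le> 1"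
    and c: "0 < c" "c \<le> 1" "\<And>v. c * norm v \<le> norm (blinfun_apply T v)"
  shows "\<exists>R\<in>M. adj R = R \<and> R o\<^sub>L T = id_blinfun \<and> T o\<^sub>L R = id_blinfun"
proof -
  define D where "D = id_blinfun - (T o\<^sub>L T)"
  have DM: "D \<in> M" using T by (simp add: D_def)
  define q where "q = sqrt (1 - c\<^sup>2)"
  have q: "0 \<le> q" "q < 1" "q\<^sup>2 = 1 - c\<^sup>2"
    using c by (auto simp: q_def power_le_one real_sqrt_lt_1_iff)
  have D_norm: "norm D \<le> q"
  proof (rule norm_blinfun_bound)
    fix v
    have "(norm (blinfun_apply D v))\<^sup>2 \<le> (norm v)\<^sup>2 - (norm (blinfun_apply T v))\<^sup>2"
      using norm_id_minus_adj_compose[OF T(1,3), of v] T(2) by (simp add: D_def blinfun.bilinear_simps)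
    also have "\<dots> \<le> (norm v)\<^sup>2 - (c * norm v)\<^sup>2"
      using c by (intro diff_left_mono power_mono) auto
    also have "\<dots> = (q * norm v)\<^sup>2"
      by (simp add: power_mult_distrib q(3) algebra_simps)
    finally show "norm (blinfun_apply D v) \<le> q * norm v"
      by (rule power2_le_imp_le) (use q in simp)
  qed (use q in simp)
  have "\<exists>!r\<in>M. id_blinfun + (r o\<^sub>L D) = r"
  proof (rule Banach_fix)
    show "complete M"
      using closed_M by (simp add: complete_eq_closed)
    show "dist (id_blinfun + (r o\<^sub>L D)) (id_blinfun + (r' o\<^sub>L D)) \<le> q * dist r r'" for r r'
    proof -
      have "norm ((r - r') o\<^sub>L D) \<le> norm (r - r') * q"
        using norm_blinfun_compose[of "r - r'" D] D_norm
        by (meson mult_left_mono norm_ge_zero order_trans)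
      then show ?thesis
        by (simp add: dist_norm blinfun_compose_bilinear mult.commute)
    qed
    show "M \<noteq> {}"
      using M_id by blast
  qed (use q DM in auto)
  then obtain r where r: "r \<in> M" "id_blinfun + (r o\<^sub>L D) = r"
    by blast
  then have rTT: "r o\<^sub>L (T o\<^sub>L T) = id_blinfun"
    by (simp add: D_def blinfun_compose_bilinear)
  \<comment> \<open>Self-adjointness of T turns the left inverse of T^2 into a right
    inverse.\<close>
  have "adj (r o\<^sub>L (T o\<^sub>L T)) = adj id_blinfun"
    using rTT by simp
  then have TTr: "T o\<^sub>L (T o\<^sub>L adj r) = id_blinfun"
    using r(1) T by (simp add: blinfun_compose_assoc)
  have "r = r o\<^sub>L (T o\<^sub>L (T o\<^sub>L adj r))"
    using TTr by simp
  also have "\<dots> = (r o\<^sub>L (T o\<^sub>L T)) o\<^sub>L adj r"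
    by (simp add: blinfun_compose_assoc)
  finally have r_adj: "adj r = r"
    using rTT by simp
  have RT: "(r o\<^sub>L T) o\<^sub>L T = id_blinfun" and TR: "T o\<^sub>L (T o\<^sub>L r) = id_blinfun"
    using rTT TTr r_adj by (simp_all add: blinfun_compose_assoc)
  have "r o\<^sub>L T = ((r o\<^sub>L T) o\<^sub>L T) o\<^sub>L (T o\<^sub>L r)"
    using TR by (simp add: blinfun_compose_assoc)
  then have eq: "r o\<^sub>L T = T o\<^sub>L r"
    using RT by simp
  show ?thesis
    using r T RT TR r_adj eq by (intro bexI[of _ "r o\<^sub>L T"]) auto
qed

text \<open>The range of e is the kernel of s - k, where s is the absolute value of k: this is the
  spectral projection of k for the half-line [0, infinity). On its range k = s, and on the
  orthogonal complement k = -s.\<close>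

lemma ex_spectral_projection:
  assumes k: "k \<in> M" "adj k = k" "norm k \<le> 1"
  shows "\<exists>e\<in>M. adj e = e \<and> e o\<^sub>L e = e \<and>
    (\<forall>C\<in>bounded_operators. C o\<^sub>L k = k o\<^sub>L C \<and> adj C o\<^sub>L k = k o\<^sub>L adj C \<longrightarrow> e o\<^sub>L C = C o\<^sub>L e) \<and>
    (\<forall>v. 0 \<le> inner (blinfun_apply k (blinfun_apply e v)) (blinfun_apply e v)) \<and>
    (\<forall>v. inner (blinfun_apply k (v - blinfun_apply e v)) (v - blinfun_apply e v) \<le> 0)"
proof -
  obtain s where s: "s \<in> M" "adj s = s" "s o\<^sub>L s = k o\<^sub>L k" "\<And>v. inner (blinfun_apply s v) v \<ge> 0"
    "\<And>C. C o\<^sub>L (k o\<^sub>L k) = (k o\<^sub>L k) o\<^sub>L C \<Longrightarrow> C o\<^sub>L s = s o\<^sub>L C"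
    using ex_absolute_value[OF k(1,3)] unfolding k(2) by blast
  define S where "S = {v. blinfun_apply s v = blinfun_apply k v}"
  have S_inv: "blinfun_apply C v \<in> S" if C: "C o\<^sub>L k = k o\<^sub>L C" and v: "v \<in> S" for C v
  proof -
    have "C o\<^sub>L (k o\<^sub>L k) = (k o\<^sub>L k) o\<^sub>L C"
      using C by (metis blinfun_compose_assoc)
    then have "C o\<^sub>L s = s o\<^sub>L C" by (rule s(5))
    then have "blinfun_apply s (blinfun_apply C v) = blinfun_apply C (blinfun_apply s v)"
      "blinfun_apply k (blinfun_apply C v) = blinfun_apply C (blinfun_apply k v)"
      using C by (simp_all flip: blinfun_apply_blinfun_compose)
    then show ?thesis
      using v by (simp add: S_def)
  qed
  have sk: "k o\<^sub>L s = s o\<^sub>L k"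
    by (rule s(5)) (simp add: blinfun_compose_assoc)
  have "closed S"
    unfolding S_def by (intro closed_Collect_eq continuous_intros)
  moreover have "subspace S"
    by (simp add: S_def subspace_def blinfun.bilinear_simps)
  moreover have "blinfun_apply C v \<in> S" if "C \<in> commutant M" "v \<in> S" for C v
    using that k(1) by (intro S_inv) (auto simp: commutant_def)
  ultimately obtain e where e: "e \<in> M" "adj e = e" "e o\<^sub>L e = e" "\<And>v. (blinfun_apply e v = v) = (v \<in> S)"
    "\<And>T. T \<in> bounded_operators \<Longrightarrow>
      \<forall>v\<in>S. blinfun_apply T v \<in> S \<and> blinfun_apply (adj T) v \<in> S \<Longrightarrow> e o\<^sub>L T = T o\<^sub>L e"
    using ex_projection_in_M[of S] by metis
  have eS: "blinfun_apply e v \<in> S" for v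
    using e(3) e(4)[of "blinfun_apply e v"] by (metis blinfun_apply_blinfun_compose)
  have comm: "e o\<^sub>L C = C o\<^sub>L e"
    if "C \<in> bounded_operators" "C o\<^sub>L k = k o\<^sub>L C" "adj C o\<^sub>L k = k o\<^sub>L adj C" for C
    using that by (intro e(5)) (auto intro: S_inv)
  have pos: "0 \<le> inner (blinfun_apply k (blinfun_apply e v)) (blinfun_apply e v)" for v
    using s(4)[of "blinfun_apply e v"] eS[of v] by (simp add: S_def)
  have neg: "inner (blinfun_apply k (v - blinfun_apply e v)) (v - blinfun_apply e v) \<le> 0" for v
  proof -
    let ?w = "v - blinfun_apply e v"
    let ?u = "blinfun_apply (k + s) ?w"
    \<comment> \<open>Since s^2 = k^2, the operator k + s maps everything into S, while w is
      orthogonal to S. Hence |(k + s) w|^2 is the inner product of w with (k + s)^2 w, which is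
      0.\<close>
    have "s o\<^sub>L (k + s) = k o\<^sub>L (k + s)"
      by (simp add: blinfun_compose_bilinear s(3) sk)
    then have "?u \<in> S"
      by (simp add: S_def flip: blinfun_apply_blinfun_compose)
    moreover have "(k + s) o\<^sub>L k = k o\<^sub>L (k + s)"
      by (simp add: blinfun_compose_bilinear sk)
    ultimately have "blinfun_apply (k + s) ?u \<in> S"
      by (rule S_inv[rotated])
    then have eu: "blinfun_apply e (blinfun_apply (k + s) ?u) = blinfun_apply (k + s) ?u"
      by (simp add: e(4))
    have "inner ?u ?u = inner ?w (blinfun_apply (k + s) ?u)"
      using inner_adj_right[of "k + s" ?w ?u] k(1,2) s(1,2) by simp
    also have "\<dots> = inner ?w (blinfun_apply e (blinfun_apply (k + s) ?u))"
      by (simp only: eu)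
    also have "\<dots> = inner (blinfun_apply e ?w) (blinfun_apply (k + s) ?u)"
      using inner_adj_right[of e ?w "blinfun_apply (k + s) ?u"] e(1,2) by simp
    also have "blinfun_apply e ?w = 0"
      using e(3) by (simp add: blinfun.bilinear_simps flip: blinfun_apply_blinfun_compose)
    finally have "?u = 0" by simp
    then have "blinfun_apply k ?w = - blinfun_apply s ?w"
      by (simp add: blinfun.add_left eq_neg_iff_add_eq_0)
    then show ?thesis
      using s(4)[of ?w] by simp
  qed
  show ?thesis
    using e(1-3) comm pos neg by blast
qed

end

section \<open>Extreme points have the stated form\<close>

context vna
begin

text \<open>Both weights are sqrt(1/2) times the identity. Every decomposition against which an
  extreme point is tested below has this form.\<close>

lemma cstar_extreme_midpoint:
  assumes ext: "cstar_extreme_point M x" and yz: "y \<in> unit_ball M" "z \<in> unit_ball M"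
    and x: "x = (1/2) *\<^sub>R (y + z)"
  shows "\<exists>u. unitary_in M id_blinfun u \<and> y = adj u o\<^sub>L x o\<^sub>L u"
proof -
  define t where "t = (\<lambda>_::nat. sqrt (1/2) *\<^sub>R (id_blinfun :: 'h \<Rightarrow>\<^sub>L 'h))"
  define w where "w = (\<lambda>i::nat. if i = 1 then y else z)"
  have two: "{1..2} = {1, 2::nat}" by auto
  have half: "(1/2) *\<^sub>R id_blinfun + (1/2) *\<^sub>R id_blinfun = (id_blinfun :: 'h \<Rightarrow>\<^sub>L 'h)"
    by (simp flip: scaleR_left_distrib)
  have t_adj: "adj (t i) = t i" for i
    by (simp add: t_def)
  have "t i \<in> M" for i
    by (simp add: t_def)
  moreover have "(sqrt 2 *\<^sub>R id_blinfun) o\<^sub>L t i = id_blinfun" "t i o\<^sub>L (sqrt 2 *\<^sub>R id_blinfun) = id_blinfun" for i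
    by (simp_all add: t_def blinfun_compose_bilinear real_sqrt_divide)
  ultimately have inv: "invertible_in M id_blinfun (t i)" for i
    unfolding invertible_in_def using M_scaleR[OF M_id] by blast
  have one: "(\<Sum>i\<in>{1..2}. adj (t i) o\<^sub>L t i) = id_blinfun"
    unfolding two t_adj using half by (simp add: t_def blinfun_compose_bilinear)
  have sum: "x = (\<Sum>i\<in>{1..2}. adj (t i) o\<^sub>L w i o\<^sub>L t i)"
    unfolding two t_adj by (simp add: t_def w_def blinfun_compose_bilinear x scaleR_right_distrib)
  have "\<forall>i\<in>{1..2}. w i \<in> unit_ball M"
    using yz by (simp add: w_def)
  then obtain u where "\<forall>i\<in>{1..2::nat}. unitary_in M id_blinfun (u i) \<and> w i = (adj (u i) o\<^sub>L x o\<^sub>L u i)"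
    using ext inv one sum unfolding cstar_extreme_point_def by (metis (no_types, lifting))
  then have "unitary_in M id_blinfun (u 1) \<and> w 1 = (adj (u 1) o\<^sub>L x o\<^sub>L u 1)"
    by (metis atLeastAtMost_iff one_le_numeral order_refl)
  then show ?thesis
    by (auto simp: w_def)
qed

lemma partial_isometry_unitary_conjugate:
  assumes x: "x \<in> M" and u: "unitary_in M id_blinfun u" and y: "y = adj u o\<^sub>L x o\<^sub>L u"
  shows "y o\<^sub>L adj y o\<^sub>L y = y \<longleftrightarrow> x o\<^sub>L adj x o\<^sub>L x = x"
proof -
  have uM: "u \<in> M" and uu: "adj u o\<^sub>L u = id_blinfun" "u o\<^sub>L adj u = id_blinfun"
    using u by (auto simp: unitary_in_def)
  note simps = blinfun_compose_assoc uu uu[THEN blinfun_compose_extend]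
  have "adj y = adj u o\<^sub>L adj x o\<^sub>L u"
    using x uM by (simp add: y blinfun_compose_assoc)
  then have yyy: "y o\<^sub>L adj y o\<^sub>L y = adj u o\<^sub>L (x o\<^sub>L adj x o\<^sub>L x) o\<^sub>L u"
    by (simp add: y simps)
  have "u o\<^sub>L (adj u o\<^sub>L w o\<^sub>L u) o\<^sub>L adj u = w" for w
    by (simp add: simps)
  then show ?thesis
    unfolding yyy by (metis y)
qed

text \<open>With $e$ the spectral projection of $|x|$ for $[1/2, \infty)$ and $R$ the inverse of
  $|x|e + (1 - e)$, the partial isometry $x_1 = xRe$ and the contraction $2x - x_1$ have midpoint $x$.\<close>

lemma cstar_extreme_imp_partial_isometry:
  assumes ext: "cstar_extreme_point M x"
  shows "x o\<^sub>L adj x o\<^sub>L x = x"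
proof -
  have x: "x \<in> M" "norm x \<le> 1"
    using ext by (auto simp: cstar_extreme_point_def unit_ball_def)
  obtain m where m: "m \<in> M" "adj m = m" "m o\<^sub>L m = adj x o\<^sub>L x" "\<And>v. inner (blinfun_apply m v) v \<ge> 0"
    using ex_absolute_value[OF x] by blast
  have m_inner: "inner (blinfun_apply m v) w = inner v (blinfun_apply m w)" for v w
    using inner_adj_right[of m v w] m by simp
  have mx: "norm (blinfun_apply m v) = norm (blinfun_apply x v)" for v
  proof -
    have "(norm (blinfun_apply m v))\<^sup>2 = (norm (blinfun_apply x v))\<^sup>2"
      using norm_adj_compose[of m v] norm_adj_compose[of x v] m(1-3) x(1) by simp
    then show ?thesis by simp
  qed
  have m_le: "norm (blinfun_apply m v) \<le> norm v" for v
    using norm_blinfun_le_1D[OF x(2)] by (simp add: mx)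
  \<comment> \<open>Positivity of m at v - c m v, the operator form of r (1 - c r)^2 \<ge> 0. The
    values c = 1 and c = 2 are used.\<close>
  have m_quad: "2 * c * inner (blinfun_apply m v) (blinfun_apply m v) \<le>
      inner (blinfun_apply m v) v + c\<^sup>2 * inner (blinfun_apply m (blinfun_apply m v)) (blinfun_apply m v)" for c v
    using m(4)[of "v - c *\<^sub>R blinfun_apply m v"]
    by (simp add: blinfun.bilinear_simps inner_diff m_inner algebra_simps power2_eq_square)
  have m_sq: "inner (blinfun_apply m v) (blinfun_apply m v) \<le> inner (blinfun_apply m v) v" for v
  proof -
    let ?w = "blinfun_apply m v"
    have "inner (blinfun_apply m ?w) ?w \<le> norm (blinfun_apply m ?w) * norm ?w"
      by (rule norm_cauchy_schwarz)
    also have "\<dots> \<le> norm ?w * norm ?w"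
      by (intro mult_right_mono m_le) simp
    finally show ?thesis
      using m_quad[of 1 v] by (simp add: power2_norm_eq_inner flip: power2_eq_square)
  qed
  \<comment> \<open>For a spectral value r of m, the modulus of the second summand 2 x - x1 is |2 r
    - 1| above the cut, which is at most 1 throughout [0, 1], and 2 r below it. So 1/2 is the
    largest admissible cut, and a positive cut keeps the inverse on the upper part bounded.\<close>
  define k where "k = m - (1/2) *\<^sub>R id_blinfun"
  have k: "k \<in> M" "adj k = k"
    using m by (simp_all add: k_def)
  have k_norm: "norm k \<le> 1"
  proof (rule norm_blinfun_bound)
    fix v
    have "inner (blinfun_apply k v) (blinfun_apply k v) =
        inner (blinfun_apply m v) (blinfun_apply m v) - inner (blinfun_apply m v) v + inner v v / 4"
      by (simp add: k_def blinfun.bilinear_simps inner_diff inner_commute)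
    then have "(norm (blinfun_apply k v))\<^sup>2 \<le> (norm v)\<^sup>2"
      unfolding power2_norm_eq_inner using m_sq[of v] inner_ge_zero[of v] by linarith
    then show "norm (blinfun_apply k v) \<le> 1 * norm v" by simp
  qed simp
  obtain e where e: "e \<in> M" "adj e = e" "e o\<^sub>L e = e"
    and e_comm: "\<And>C. C \<in> bounded_operators \<Longrightarrow> C o\<^sub>L k = k o\<^sub>L C \<Longrightarrow> adj C o\<^sub>L k = k o\<^sub>L adj C \<Longrightarrow> e o\<^sub>L C = C o\<^sub>L e"
    and e_pos: "\<And>v. 0 \<le> inner (blinfun_apply k (blinfun_apply e v)) (blinfun_apply e v)"
    and e_neg: "\<And>v. inner (blinfun_apply k (v - blinfun_apply e v)) (v - blinfun_apply e v) \<le> 0"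
    using ex_spectral_projection[OF k k_norm] by blast
  have em: "e o\<^sub>L m = m o\<^sub>L e"
    by (rule e_comm) (use m in \<open>simp_all add: k_def blinfun_compose_bilinear\<close>)
  have em_app: "blinfun_apply e (blinfun_apply m v) = blinfun_apply m (blinfun_apply e v)" for v
    using em by (simp flip: blinfun_apply_blinfun_compose)
  have ee_app: "blinfun_apply e (blinfun_apply e v) = blinfun_apply e v" for v
    using e(3) by (simp flip: blinfun_apply_blinfun_compose)
  have orth: "inner (blinfun_apply e a) (b - blinfun_apply e b) = 0" for a b
  proof -
    have "inner (blinfun_apply e a) (b - blinfun_apply e b) = inner a (blinfun_apply e (b - blinfun_apply e b))"
      using inner_adj_right[of e a] e by simp
    then show ?thesis
      by (simp add: blinfun.bilinear_simps ee_app)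
  qed
  have pyth: "(norm (blinfun_apply e a + (b - blinfun_apply e b)))\<^sup>2 =
      (norm (blinfun_apply e a))\<^sup>2 + (norm (b - blinfun_apply e b))\<^sup>2" for a b
    using orth[of a b] by (simp add: power2_norm_eq_inner inner_add inner_commute)
  have v_split: "(norm v)\<^sup>2 = (norm (blinfun_apply e v))\<^sup>2 + (norm (v - blinfun_apply e v))\<^sup>2" for v
    using pyth[of v v] by simp
  have m_low: "inner (blinfun_apply m (blinfun_apply e v)) (blinfun_apply e v) \<ge> (norm (blinfun_apply e v))\<^sup>2 / 2" for v
    using e_pos[of v] by (simp add: k_def blinfun.bilinear_simps inner_diff power2_norm_eq_inner)
  have m_up: "inner (blinfun_apply m (v - blinfun_apply e v)) (v - blinfun_apply e v) \<le> (norm (v - blinfun_apply e v))\<^sup>2 / 2" for v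
  proof -
    have "inner (blinfun_apply k w) w = inner (blinfun_apply m w) w - (norm w)\<^sup>2 / 2" for w
      by (simp add: k_def blinfun.bilinear_simps inner_diff power2_norm_eq_inner)
    then show ?thesis
      using e_neg[of v] by simp
  qed
  define T where "T = (m o\<^sub>L e) + (id_blinfun - e)"
  have TM: "T \<in> M" and T_adj: "adj T = T"
    using m e em by (simp_all add: T_def)
  have T_norm: "(norm (blinfun_apply T v))\<^sup>2 =
      (norm (blinfun_apply m (blinfun_apply e v)))\<^sup>2 + (norm (v - blinfun_apply e v))\<^sup>2" for v
    using pyth[of "blinfun_apply m v" v] by (simp add: T_def blinfun.bilinear_simps em_app)
  have "norm T \<le> 1"
  proof (rule norm_blinfun_bound)
    fix v
    have "(norm (blinfun_apply T v))\<^sup>2 \<le> (norm v)\<^sup>2"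
      unfolding T_norm v_split[of v] by (intro add_right_mono power_mono m_le) simp
    then show "norm (blinfun_apply T v) \<le> 1 * norm v" by simp
  qed simp
  \<comment> \<open>On the range of e, |w|^2 / 2 is at most the inner product of m w and w, hence at
    most |m w| |w|. On the complement T is the identity.\<close>
  moreover have "1/2 * norm v \<le> norm (blinfun_apply T v)" for v
  proof -
    let ?w = "blinfun_apply e v"
    have "norm ?w * norm ?w \<le> 2 * (norm (blinfun_apply m ?w) * norm ?w)"
      using m_low[of v] norm_cauchy_schwarz[of "blinfun_apply m ?w" ?w] by (simp add: power2_eq_square)
    then have "1/2 * norm ?w \<le> norm (blinfun_apply m ?w)"
      by (cases "?w = 0") auto
    then have "(1/2 * norm ?w)\<^sup>2 \<le> (norm (blinfun_apply m ?w))\<^sup>2"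
      by (intro power_mono) auto
    moreover have quarter: "(1/2 * r)\<^sup>2 = r\<^sup>2 / 4" for r :: real
      by (simp add: power2_eq_square)
    ultimately have "(norm ?w)\<^sup>2 / 4 \<le> (norm (blinfun_apply m ?w))\<^sup>2"
      by metis
    then have "(1/2 * norm v)\<^sup>2 \<le> (norm (blinfun_apply T v))\<^sup>2"
      using v_split[of v] zero_le_power2[of "norm (v - ?w)"] unfolding T_norm quarter by linarith
    then show ?thesis
      by (rule power2_le_imp_le) simp
  qed
  ultimately obtain R where R: "R \<in> M" "adj R = R" "R o\<^sub>L T = id_blinfun" "T o\<^sub>L R = id_blinfun"
    using ex_selfadjoint_inverse[OF TM T_adj, of "1/2"] by auto
  have mR: "m o\<^sub>L R = R o\<^sub>L m"
    by (rule inverse_commute[OF R(3,4)])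
      (simp add: T_def blinfun_compose_bilinear em blinfun_compose_assoc)
  have "R o\<^sub>L (T o\<^sub>L e) = e"
    using R(3) by (simp flip: blinfun_compose_assoc)
  moreover have "T o\<^sub>L e = m o\<^sub>L e"
    by (simp add: T_def blinfun_compose_bilinear e blinfun_compose_assoc)
  ultimately have Rme: "R o\<^sub>L (m o\<^sub>L e) = e" by simp
  then have mRe: "m o\<^sub>L (R o\<^sub>L e) = e"
    using mR by (simp flip: blinfun_compose_assoc)
  have mRe_app: "blinfun_apply m (blinfun_apply R (blinfun_apply e v)) = blinfun_apply e v" for v
    using mRe by (simp flip: blinfun_apply_blinfun_compose)
  define x1 where "x1 = x o\<^sub>L (R o\<^sub>L e)"
  have x1M: "x1 \<in> M"
    using x e R by (simp add: x1_def)
  have e_contr: "norm (blinfun_apply e v) \<le> norm v" for v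
  proof (rule power2_le_imp_le)
    show "(norm (blinfun_apply e v))\<^sup>2 \<le> (norm v)\<^sup>2"
      unfolding v_split[of v] by simp
  qed simp
  have "norm x1 \<le> 1"
    by (rule norm_blinfun_bound) (simp_all add: x1_def mRe_app e_contr flip: mx)
  moreover have "norm (2 *\<^sub>R x - x1) \<le> 1"
  proof (rule norm_blinfun_bound)
    fix v
    let ?w = "blinfun_apply e v" and ?z = "v - blinfun_apply e v"
    \<comment> \<open>Through \<open>pyth\<close> the vector 2 m v - e v splits into (2 m - 1) e v
      in the range of e and 2 m (v - e v) orthogonal to it.\<close>
    have eqs: "blinfun_apply e (2 *\<^sub>R blinfun_apply m v - v) = 2 *\<^sub>R blinfun_apply m ?w - ?w"
      "2 *\<^sub>R blinfun_apply m v - blinfun_apply e (2 *\<^sub>R blinfun_apply m v) = 2 *\<^sub>R blinfun_apply m ?z"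
      by (simp_all add: blinfun.bilinear_simps em_app scaleR_diff_right)
    have "blinfun_apply (2 *\<^sub>R x - x1) v = blinfun_apply x (2 *\<^sub>R v - blinfun_apply R ?w)"
      by (simp add: x1_def blinfun.bilinear_simps)
    then have "norm (blinfun_apply (2 *\<^sub>R x - x1) v) = norm (blinfun_apply m (2 *\<^sub>R v - blinfun_apply R ?w))"
      by (simp add: mx)
    also have "blinfun_apply m (2 *\<^sub>R v - blinfun_apply R ?w) = blinfun_apply e (2 *\<^sub>R blinfun_apply m v - v) +
        (2 *\<^sub>R blinfun_apply m v - blinfun_apply e (2 *\<^sub>R blinfun_apply m v))"
      by (simp add: blinfun.bilinear_simps mRe_app)
    finally have "(norm (blinfun_apply (2 *\<^sub>R x - x1) v))\<^sup>2 =
        (norm (2 *\<^sub>R blinfun_apply m ?w - ?w))\<^sup>2 + (norm (2 *\<^sub>R blinfun_apply m ?z))\<^sup>2"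
      by (simp only: pyth) (simp only: eqs)
    also have "(norm (2 *\<^sub>R blinfun_apply m ?w - ?w))\<^sup>2 \<le> (norm ?w)\<^sup>2"
      using m_sq[of ?w] unfolding power2_norm_eq_inner by (simp add: inner_diff inner_commute)
    \<comment> \<open>The case c = 2 reads 4 m^2 \<le> m + 4 m^3. Below the cut m^3 \<le> m^2 / 2
      and m \<le> 1/2, so 2 m^2 \<le> m and 4 m^2 \<le> 1 there.\<close>
    also have "(norm (2 *\<^sub>R blinfun_apply m ?z))\<^sup>2 \<le> (norm ?z)\<^sup>2"
    proof -
      have mz: "blinfun_apply m ?z = blinfun_apply m v - blinfun_apply e (blinfun_apply m v)"
        by (simp add: blinfun.bilinear_simps em_app)
      have "inner (blinfun_apply m (blinfun_apply m ?z)) (blinfun_apply m ?z) \<le> (norm (blinfun_apply m ?z))\<^sup>2 / 2"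
        using m_up[of "blinfun_apply m v"] unfolding mz .
      then show ?thesis
        using m_quad[of 2 ?z] m_up[of v] by (simp add: power2_norm_eq_inner)
    qed
    finally have "(norm (blinfun_apply (2 *\<^sub>R x - x1) v))\<^sup>2 \<le> (norm v)\<^sup>2"
      unfolding v_split[of v] by simp
    then show "norm (blinfun_apply (2 *\<^sub>R x - x1) v) \<le> 1 * norm v" by simp
  qed simp
  moreover have "x = (1/2) *\<^sub>R (x1 + (2 *\<^sub>R x - x1))"
    by simp
  ultimately obtain u where u: "unitary_in M id_blinfun u" "x1 = adj u o\<^sub>L x o\<^sub>L u"
    using cstar_extreme_midpoint[OF ext, of x1 "2 *\<^sub>R x - x1"] x x1M by (auto simp: unit_ball_def)
  \<comment> \<open>Once this product is e, the relation x1 e = x1 is the partial isometry identity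
    for x1, and conjugation carries it to x.\<close>
  have "adj x1 o\<^sub>L x1 = e o\<^sub>L (R o\<^sub>L ((adj x o\<^sub>L x) o\<^sub>L (R o\<^sub>L e)))"
    using x e R by (simp add: x1_def blinfun_compose_assoc)
  also have "\<dots> = e"
    unfolding m(3)[symmetric] by (simp add: blinfun_compose_assoc mRe Rme e)
  finally have "x1 o\<^sub>L adj x1 o\<^sub>L x1 = x1"
    by (simp add: blinfun_compose_assoc) (simp add: x1_def e blinfun_compose_assoc)
  then show ?thesis
    using partial_isometry_unitary_conjugate[OF x(1) u] by simp
qed

lemma cstar_extreme_imp_zero:
  assumes ext: "cstar_extreme_point M x" and y: "y \<in> M"
  shows "(id_blinfun - (x o\<^sub>L adj x)) o\<^sub>L y o\<^sub>L (id_blinfun - (adj x o\<^sub>L x)) = 0" (is "?a = 0")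
proof (rule ccontr)
  assume neq: "?a \<noteq> 0"
  have x: "x \<in> M" "norm x \<le> 1"
    using ext by (auto simp: cstar_extreme_point_def unit_ball_def)
  have px: "x o\<^sub>L adj x o\<^sub>L x = x"
    by (rule cstar_extreme_imp_partial_isometry[OF ext])
  have "adj (x o\<^sub>L adj x o\<^sub>L x) = adj x"
    using px by simp
  then have px': "adj x o\<^sub>L (x o\<^sub>L adj x) = adj x"
    using x by simp
  \<comment> \<open>Any norm strictly between 0 and 1 would do:
    \<open>b o\<^sub>L (adj b o\<^sub>L b) = b\<close> is going to force |b| \<le> |b|^3.\<close>
  define b where "b = (1 / (2 * norm ?a)) *\<^sub>R ?a"
  have bM: "b \<in> M" and b_norm: "norm b = 1/2"
    using x y neq by (simp_all add: b_def)
  have xb: "adj x o\<^sub>L b = 0" "b o\<^sub>L adj x = 0"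
  proof -
    have left: "adj x o\<^sub>L (id_blinfun - (x o\<^sub>L adj x)) = 0"
      and right: "(id_blinfun - (adj x o\<^sub>L x)) o\<^sub>L adj x = 0"
      by (simp_all only: blinfun_compose_bilinear blinfun_compose_assoc px' id_blinfun_compose diff_self)
    show "adj x o\<^sub>L b = 0" "b o\<^sub>L adj x = 0"
      by (simp_all add: b_def blinfun_compose_assoc blinfun_compose_bilinear(7,8) right
          blinfun_compose_extend[OF left])
  qed
  have "adj (adj x o\<^sub>L b) = 0" "adj (b o\<^sub>L adj x) = 0"
    using xb adj_M(5)[OF M_id, of 0] by simp_all
  then have bx: "adj b o\<^sub>L x = 0" "x o\<^sub>L adj b = 0"
    using x bM by simp_all
  have b_sub: "b o\<^sub>L (id_blinfun - (adj x o\<^sub>L x)) = b"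
    by (simp add: blinfun_compose_bilinear blinfun_compose_extend[OF xb(2)])
  \<comment> \<open>The vectors x v and b v are orthogonal, and b sees only the component of v under
    \<open>id_blinfun - (adj x o\<^sub>L x)\<close>, whose squared length is at most |v|^2 - |x
    v|^2.\<close>
  have contr: "norm (x + c *\<^sub>R b) \<le> 1" if "\<bar>c\<bar> = 1" for c
  proof (rule norm_blinfun_bound)
    fix v
    have "inner (blinfun_apply x v) (blinfun_apply b v) = inner v (blinfun_apply (adj x o\<^sub>L b) v)"
      using x by (simp add: inner_adj_right)
    then have "inner (blinfun_apply x v) (blinfun_apply b v) = 0"
      by (simp add: xb)
    moreover have "c * c = 1"
      using that by (metis abs_mult_self_eq mult_1)
    ultimately have "(norm (blinfun_apply (x + c *\<^sub>R b) v))\<^sup>2 =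
        (norm (blinfun_apply x v))\<^sup>2 + (norm (blinfun_apply b v))\<^sup>2"
      by (simp add: power2_norm_eq_inner blinfun.bilinear_simps inner_add inner_commute
          flip: mult.assoc)
    also have "blinfun_apply b v = blinfun_apply b (v - blinfun_apply (adj x) (blinfun_apply x v))"
      using arg_cong[OF b_sub, of "\<lambda>B. blinfun_apply B v"] by (simp add: blinfun.bilinear_simps)
    also have "(norm (blinfun_apply b (v - blinfun_apply (adj x) (blinfun_apply x v))))\<^sup>2 \<le>
        (norm v)\<^sup>2 - (norm (blinfun_apply x v))\<^sup>2"
      using b_norm norm_id_minus_adj_compose[OF x, of v]
      by (intro order_trans[OF power_mono[OF norm_blinfun_le_1D]]) auto
    finally show "norm (blinfun_apply (x + c *\<^sub>R b) v) \<le> 1 * norm v"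
      by simp
  qed simp
  have "x + b \<in> unit_ball M" "x - b \<in> unit_ball M"
    using x bM contr[of 1] contr[of "-1"] by (simp_all add: unit_ball_def)
  moreover have "x = (1/2) *\<^sub>R ((x + b) + (x - b))"
    by (simp flip: scaleR_2)
  ultimately obtain u where u: "unitary_in M id_blinfun u" "x + b = adj u o\<^sub>L x o\<^sub>L u"
    using cstar_extreme_midpoint[OF ext] by blast
  have "(x + b) o\<^sub>L adj (x + b) o\<^sub>L (x + b) = x + b"
    using partial_isometry_unitary_conjugate[OF x(1) u] px by simp
  \<comment> \<open>Every mixed term of the expanded triple product contains one of the vanishing
    pairs in \<open>xb\<close> and \<open>bx\<close>.\<close>
  then have "b o\<^sub>L (adj b o\<^sub>L b) = b"
    using x bM px by (simp add: op_simps xb bx xb[THEN blinfun_compose_extend] bx[THEN blinfun_compose_extend])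
  then have "norm b \<le> norm b * (norm (adj b) * norm b)"
    by (metis norm_blinfun_compose mult_left_mono norm_ge_zero order_trans)
  also have "\<dots> \<le> norm b * (norm b * norm b)"
    using bM by (intro mult_left_mono mult_right_mono norm_adj_le) auto
  finally show False
    by (simp add: b_norm)
qed

text \<open>K consists of the vectors killed by Q M. Its invariance under the commutant puts the
  projection z into M, and its invariance under M makes z central. The hypothesis places the range
  of P in K; as the identity lies in M, Q vanishes on K.\<close>

lemma ex_separating_central_projection:
  assumes PQ: "P \<in> M" "Q \<in> M" and zero: "\<And>y. y \<in> M \<Longrightarrow> Q o\<^sub>L y o\<^sub>L P = 0"
  shows "\<exists>z. central_projection M z \<and> z o\<^sub>L P = P \<and> Q o\<^sub>L z = 0"
proof -
  define K where "K = {v. \<forall>y\<in>M. blinfun_apply (Q o\<^sub>L y) v = 0}"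
  have K_eq: "K = (\<Inter>y\<in>M. {v. blinfun_apply (Q o\<^sub>L y) v = 0})"
    by (auto simp: K_def)
  have "closed K"
    unfolding K_eq by (intro closed_INT ballI closed_Collect_eq continuous_intros)
  moreover have "subspace K"
    by (simp add: K_def subspace_def blinfun.bilinear_simps)
  moreover have "blinfun_apply C v \<in> K" if C: "C \<in> commutant M" and v: "v \<in> K" for C v
  proof -
    have "(Q o\<^sub>L y) o\<^sub>L C = C o\<^sub>L (Q o\<^sub>L y)" if "y \<in> M" for y
      using C PQ that by (simp add: commutant_def)
    then have "blinfun_apply (Q o\<^sub>L y) (blinfun_apply C v) = blinfun_apply C (blinfun_apply (Q o\<^sub>L y) v)"
      if "y \<in> M" for y
      using that by (metis blinfun_apply_blinfun_compose)
    then show ?thesis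
      using v by (simp add: K_def blinfun.bilinear_simps)
  qed
  ultimately obtain z where z: "z \<in> M" "adj z = z" "z o\<^sub>L z = z" "\<And>v. (blinfun_apply z v = v) = (v \<in> K)"
    "\<And>T. T \<in> bounded_operators \<Longrightarrow>
      \<forall>v\<in>K. blinfun_apply T v \<in> K \<and> blinfun_apply (adj T) v \<in> K \<Longrightarrow> z o\<^sub>L T = T o\<^sub>L z"
    using ex_projection_in_M[of K] by metis
  have inv: "blinfun_apply T v \<in> K" if "T \<in> M" "v \<in> K" for T v
  proof -
    have "blinfun_apply (Q o\<^sub>L (y o\<^sub>L T)) v = 0" if "y \<in> M" for y
      using \<open>v \<in> K\<close> \<open>T \<in> M\<close> that by (simp add: K_def del: blinfun_apply_blinfun_compose)
    then show ?thesis
      by (simp add: K_def)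
  qed
  have "central_projection M z"
    using z(1-3) by (auto simp: central_projection_def intro!: z(5) inv)
  moreover have "z o\<^sub>L P = P"
  proof (rule blinfun_eqI)
    fix v
    have "blinfun_apply P v \<in> K"
      using zero by (simp add: K_def flip: blinfun_apply_blinfun_compose)
    then show "blinfun_apply (z o\<^sub>L P) v = blinfun_apply P v"
      using z(4) by simp
  qed
  moreover have "Q o\<^sub>L z = 0"
  proof (rule blinfun_eqI)
    fix v
    have "blinfun_apply z (blinfun_apply z v) = blinfun_apply z v"
      using z(3) by (metis blinfun_apply_blinfun_compose)
    then have "blinfun_apply z v \<in> K"
      using z(4) by blast
    then have "blinfun_apply (Q o\<^sub>L id_blinfun) (blinfun_apply z v) = 0"
      using M_id unfolding K_def by blast
    then show "blinfun_apply (Q o\<^sub>L z) v = blinfun_apply 0 v"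
      by simp
  qed
  ultimately show ?thesis by blast
qed

section \<open>Corners and the central decomposition of an extreme point\<close>

lemma corner_iff:
  assumes p: "central_projection M p" and x: "x \<in> M"
  shows "isometry_in (corner p M) p (p o\<^sub>L x) \<longleftrightarrow> p o\<^sub>L (adj x o\<^sub>L x) = p"
    and "coisometry_in (corner p M) p (p o\<^sub>L x) \<longleftrightarrow> p o\<^sub>L (x o\<^sub>L adj x) = p"
    and "unitary_in (corner p M) p (p o\<^sub>L x) \<longleftrightarrow> p o\<^sub>L (adj x o\<^sub>L x) = p \<and> p o\<^sub>L (x o\<^sub>L adj x) = p"
proof -
  have pM: "p \<in> M" "adj p = p" "p o\<^sub>L p = p" and pc: "\<And>y. y \<in> M \<Longrightarrow> p o\<^sub>L y = y o\<^sub>L p"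
    using p by (auto simp: central_projection_def)
  have adj: "adj (p o\<^sub>L x) = p o\<^sub>L adj x"
    using x pM pc[of "adj x"] by simp
  have "adj x o\<^sub>L (p o\<^sub>L x) = p o\<^sub>L (adj x o\<^sub>L x)" "x o\<^sub>L (p o\<^sub>L adj x) = p o\<^sub>L (x o\<^sub>L adj x)"
    using pc[OF x] pc[OF M_closed(3)[OF x]] by (metis blinfun_compose_assoc)+
  then have "adj (p o\<^sub>L x) o\<^sub>L (p o\<^sub>L x) = p o\<^sub>L (adj x o\<^sub>L x)" "(p o\<^sub>L x) o\<^sub>L adj (p o\<^sub>L x) = p o\<^sub>L (x o\<^sub>L adj x)"
    unfolding adj by (simp_all add: blinfun_compose_assoc blinfun_compose_extend[OF pM(3)])
  moreover have "p o\<^sub>L x \<in> corner p M"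
    using x by (auto simp: corner_def)
  ultimately show "isometry_in (corner p M) p (p o\<^sub>L x) \<longleftrightarrow> p o\<^sub>L (adj x o\<^sub>L x) = p"
    and "coisometry_in (corner p M) p (p o\<^sub>L x) \<longleftrightarrow> p o\<^sub>L (x o\<^sub>L adj x) = p"
    and "unitary_in (corner p M) p (p o\<^sub>L x) \<longleftrightarrow> p o\<^sub>L (adj x o\<^sub>L x) = p \<and> p o\<^sub>L (x o\<^sub>L adj x) = p"
    by (auto simp: isometry_in_def coisometry_in_def unitary_in_def)
qed

lemma central_projection_complement:
  "central_projection M z \<Longrightarrow> central_projection M (id_blinfun - z)"
  by (auto simp: central_projection_def blinfun_compose_bilinear)

text \<open>For the separating projection w, the relation w P = P makes x isometric over 1 - w, and
  Q w = 0 makes it coisometric over w. So z is 1 - w.\<close>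

lemma cstar_extreme_imp_central_decomposition:
  assumes ext: "cstar_extreme_point M x"
  shows "\<exists>z. central_projection M z \<and> z o\<^sub>L (adj x o\<^sub>L x) = z \<and>
    (id_blinfun - z) o\<^sub>L (x o\<^sub>L adj x) = id_blinfun - z"
proof -
  have x: "x \<in> M"
    using ext by (auto simp: cstar_extreme_point_def unit_ball_def)
  let ?P = "id_blinfun - (adj x o\<^sub>L x)" and ?Q = "id_blinfun - (x o\<^sub>L adj x)"
  obtain w where w: "central_projection M w" "w o\<^sub>L ?P = ?P" "?Q o\<^sub>L w = 0"
    using ex_separating_central_projection[of ?P ?Q] cstar_extreme_imp_zero[OF ext] x by auto
  have "?Q o\<^sub>L w = w o\<^sub>L ?Q"
    using w(1) x by (simp add: central_projection_def)
  then have "w o\<^sub>L (x o\<^sub>L adj x) = w"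
    using w(3) by (simp add: blinfun_compose_bilinear)
  moreover have "(id_blinfun - w) o\<^sub>L (adj x o\<^sub>L x) = id_blinfun - w"
    using w(2) by (simp add: blinfun_compose_bilinear algebra_simps)
  ultimately show ?thesis
    using central_projection_complement[OF w(1)] by (intro exI[of _ "id_blinfun - w"]) simp
qed

end

section \<open>Similar isometries are unitarily equivalent\<close>

text \<open>The increments are dominated by those of a convergent scalar sequence. In the
  application g n is the squared length of (adj x)^n v, which decreases for an isometry x.\<close>

lemma Cauchy_of_increments:
  fixes u :: "nat \<Rightarrow> 'a::real_normed_vector" and g :: "nat \<Rightarrow> real"
  assumes g: "decseq g" "\<And>n. 0 \<le> g n" and c: "0 \<le> c"
    and u: "\<And>n k. (norm (u (n + k) - u n))\<^sup>2 \<le> c * (g n - g (n + k))"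
  shows "Cauchy u"
proof (rule metric_CauchyI)
  fix e :: real assume "0 < e"
  have "convergent g"
    by (rule decseq_convergent[OF g(1), of 0]) (auto simp: g(2) convergent_def)
  then have "Cauchy g"
    by (rule convergent_Cauchy)
  \<comment> \<open>Dividing by c + 1 covers the case c = 0.\<close>
  have "0 < e\<^sup>2 / (c + 1)"
    using \<open>0 < e\<close> c by simp
  then obtain N where N: "\<And>m n. m \<ge> N \<Longrightarrow> n \<ge> N \<Longrightarrow> dist (g m) (g n) < e\<^sup>2 / (c + 1)"
    using \<open>Cauchy g\<close> by (meson metric_CauchyD)
  have lt: "dist (u m) (u n) < e" if "m \<ge> n" "n \<ge> N" for m n
  proof -
    have "g n - g m < e\<^sup>2 / (c + 1)"
      using N[of m n] that by (simp add: dist_real_def)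
    moreover have "0 \<le> g n - g m"
      using g(1) that(1) by (simp add: decseq_def)
    ultimately have "c * (g n - g m) < e\<^sup>2"
      using c by (smt (verit, best) mult_right_mono pos_less_divide_eq mult.commute)
    then have "(norm (u m - u n))\<^sup>2 < e\<^sup>2"
      using u[of n "m - n"] that by simp
    then show ?thesis
      using \<open>0 < e\<close> by (metis dist_norm power_less_imp_less_base less_imp_le)
  qed
  have "dist (u m) (u n) < e" if "m \<ge> N" "n \<ge> N" for m n
    using lt[of m n] lt[of n m] that by (cases "m \<ge> n") (auto simp: dist_commute)
  then show "\<exists>M. \<forall>m\<ge>M. \<forall>n\<ge>M. dist (u m) (u n) < e" by blast
qed

lemma ex_strong_limit:
  fixes T :: "nat \<Rightarrow> 'a::real_normed_vector \<Rightarrow>\<^sub>L 'b::real_normed_vector"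
  assumes conv: "\<And>v. convergent (\<lambda>n. blinfun_apply (T n) v)" and C: "\<And>n. norm (T n) \<le> C"
  shows "\<exists>L. \<forall>v. (\<lambda>n. blinfun_apply (T n) v) \<longlonglongrightarrow> blinfun_apply L v"
proof -
  define f where "f v = lim (\<lambda>n. blinfun_apply (T n) v)" for v
  have f: "(\<lambda>n. blinfun_apply (T n) v) \<longlonglongrightarrow> f v" for v
    using conv by (simp add: f_def convergent_LIMSEQ_iff)
  have "bounded_linear f"
  proof (rule bounded_linear_intro[where K = C])
    fix v w r
    have "(\<lambda>n. blinfun_apply (T n) (v + w)) \<longlonglongrightarrow> f v + f w"
      unfolding blinfun.add_right by (intro tendsto_intros f)
    then show "f (v + w) = f v + f w"
      using f LIMSEQ_unique by blast
    have "(\<lambda>n. blinfun_apply (T n) (r *\<^sub>R v)) \<longlonglongrightarrow> r *\<^sub>R f v"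
      unfolding blinfun.scaleR_right by (intro tendsto_intros f)
    then show "f (r *\<^sub>R v) = r *\<^sub>R f v"
      using f LIMSEQ_unique by blast
    have "norm (blinfun_apply (T n) v) \<le> norm v * C" for n
      using norm_blinfun[of "T n" v] mult_right_mono[OF C[of n], of "norm v"]
      by (simp add: mult.commute)
    moreover have "(\<lambda>n. norm (blinfun_apply (T n) v)) \<longlonglongrightarrow> norm (f v)"
      by (intro tendsto_norm f)
    ultimately show "norm (f v) \<le> norm v * C"
      by (intro LIMSEQ_le_const2) blast+
  qed
  then have "blinfun_apply (Blinfun f) = f"
    by (rule bounded_linear_Blinfun_apply)
  then show ?thesis
    using f by (intro exI[of _ "Blinfun f"]) simp
qed

text \<open>Composition is jointly strongly continuous on bounded sets: \<open>p n\<close> applied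
  to \<open>s n\<close> v is split at S v, and the error is at most C times the distance of
  \<open>s n\<close> v from S v.\<close>

lemma strong_limit_inverse:
  assumes P: "\<And>v. (\<lambda>n. blinfun_apply (p n) v) \<longlonglongrightarrow> blinfun_apply P v" "\<And>n. norm (p n) \<le> C"
    and S: "\<And>v. (\<lambda>n. blinfun_apply (s n) v) \<longlonglongrightarrow> blinfun_apply S v"
    and ps: "\<And>n. p n o\<^sub>L s n = id_blinfun"
  shows "P o\<^sub>L S = id_blinfun"
proof (rule blinfun_eqI)
  fix v
  let ?d = "\<lambda>n. blinfun_apply (s n) v - blinfun_apply S v"
  have "(\<lambda>n. C * norm (?d n)) \<longlonglongrightarrow> C * norm (blinfun_apply S v - blinfun_apply S v)"
    by (intro tendsto_intros S)
  then have lim: "(\<lambda>n. C * norm (?d n)) \<longlonglongrightarrow> 0"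
    by simp
  have "norm (blinfun_apply (p n) (?d n)) \<le> C * norm (?d n)" for n
    using norm_blinfun[of "p n" "?d n"] mult_right_mono[OF P(2)[of n], of "norm (?d n)"] by simp
  then have "(\<lambda>n. blinfun_apply (p n) (?d n)) \<longlonglongrightarrow> 0"
    by (intro Lim_null_comparison[OF always_eventually lim]) blast
  then have "(\<lambda>n. blinfun_apply (p n) (?d n) + blinfun_apply (p n) (blinfun_apply S v)) \<longlonglongrightarrow> 0 + blinfun_apply P (blinfun_apply S v)"
    by (intro tendsto_add P)
  moreover have "blinfun_apply (p n) (?d n) + blinfun_apply (p n) (blinfun_apply S v) = v" for n
    using arg_cong[OF ps[of n], of "\<lambda>B. blinfun_apply B v"] by (simp add: blinfun.bilinear_simps)
  ultimately show "blinfun_apply (P o\<^sub>L S) v = blinfun_apply id_blinfun v"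
    by (simp add: LIMSEQ_const_iff)
qed

context vna
begin

text \<open>Unfolded, \<open>D n\<close> is the sum over j < n of y^j a (adj x)^j. Since a maps into
  the kernel of \<open>adj y\<close>, the summands have mutually orthogonal ranges. Since a vanishes
  on the range of x, the j-th summand at v has squared length at most |a|^2 times the drop from
  |(adj x)^j v|^2 to |(adj x)^(j+1) v|^2, and these drops telescope.\<close>

lemma shift_series_converges:
  assumes x: "x \<in> M" "adj x o\<^sub>L x = id_blinfun" and y: "y \<in> M" "adj y o\<^sub>L y = id_blinfun"
    and a: "a \<in> M" "a o\<^sub>L x = 0" "adj y o\<^sub>L a = 0"
    and D: "D 0 = 0" "\<And>n. D (Suc n) = a + (y o\<^sub>L (D n o\<^sub>L adj x))"
  shows "\<exists>L. \<forall>v. (\<lambda>n. blinfun_apply (D n) v) \<longlonglongrightarrow> blinfun_apply L v"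
    and "norm (D n) \<le> norm a"
proof -
  define f where "f = blinfun_apply (adj x)"
  define g where "g v n = (norm ((f ^^ n) v))\<^sup>2" for v n
  have x_norm: "norm x \<le> 1"
    using isometry_norm[of x] x by (intro norm_blinfun_bound) auto
  have x'_norm: "norm (adj x) \<le> 1"
    using norm_adj_le[of x] x x_norm by simp
  have y_iso: "norm (blinfun_apply y v) = norm v" for v
    using isometry_norm[of y] y by simp
  have "a o\<^sub>L (x o\<^sub>L adj x) = 0"
    using a(2) by (simp flip: blinfun_compose_assoc)
  then have a_sub: "a o\<^sub>L (id_blinfun - (x o\<^sub>L adj x)) = a"
    by (simp add: blinfun_compose_bilinear)
  have a_norm: "(norm (blinfun_apply a v))\<^sup>2 \<le> (norm a)\<^sup>2 * ((norm v)\<^sup>2 - (norm (f v))\<^sup>2)" for v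
  proof -
    have "blinfun_apply a v = blinfun_apply a (v - blinfun_apply x (f v))"
      using arg_cong[OF a_sub, of "\<lambda>B. blinfun_apply B v"] by (simp add: blinfun.bilinear_simps f_def)
    then have "norm (blinfun_apply a v) \<le> norm a * norm (v - blinfun_apply x (f v))"
      using norm_blinfun by metis
    then have "(norm (blinfun_apply a v))\<^sup>2 \<le> (norm a)\<^sup>2 * (norm (v - blinfun_apply x (f v)))\<^sup>2"
      by (metis norm_ge_zero power_mono power_mult_distrib)
    also have "\<dots> \<le> (norm a)\<^sup>2 * ((norm v)\<^sup>2 - (norm (f v))\<^sup>2)"
      using norm_id_minus_adj_compose[of "adj x" v] x x'_norm by (intro mult_left_mono) (simp_all add: f_def)
    finally show ?thesis .
  qed
  have bound: "(norm (blinfun_apply (D n) v))\<^sup>2 \<le> (norm a)\<^sup>2 * ((norm v)\<^sup>2 - g v n)" for n v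
  proof (induction n arbitrary: v)
    case (Suc n)
    let ?w = "blinfun_apply (D n) (f v)"
    have "inner (blinfun_apply y ?w) (blinfun_apply a v) = inner ?w (blinfun_apply (adj y o\<^sub>L a) v)"
      using y by (simp add: inner_adj_right)
    then have orth: "inner (blinfun_apply y ?w) (blinfun_apply a v) = 0"
      by (simp add: a(3))
    have "blinfun_apply (D (Suc n)) v = blinfun_apply a v + blinfun_apply y ?w"
      by (simp add: D(2) blinfun.bilinear_simps f_def)
    then have "(norm (blinfun_apply (D (Suc n)) v))\<^sup>2 = (norm (blinfun_apply a v))\<^sup>2 + (norm (blinfun_apply y ?w))\<^sup>2"
      using orth by (simp add: power2_norm_eq_inner inner_add inner_commute)
    also have "\<dots> \<le> (norm a)\<^sup>2 * ((norm v)\<^sup>2 - (norm (f v))\<^sup>2) + (norm a)\<^sup>2 * ((norm (f v))\<^sup>2 - g (f v) n)"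
      using a_norm[of v] Suc[of "f v"] unfolding y_iso by (rule add_mono)
    also have "g (f v) n = g v (Suc n)"
      by (simp add: g_def funpow_swap1)
    finally show ?case
      by (simp add: algebra_simps)
  qed (simp add: D(1) g_def)
  \<comment> \<open>The tail D (n + k) - D n is y^n D k (adj x)^n, and y^n preserves norms.\<close>
  have incr: "norm (blinfun_apply (D (n + k)) v - blinfun_apply (D n) v) = norm (blinfun_apply (D k) ((f ^^ n) v))" for n k v
  proof (induction n arbitrary: v)
    case (Suc n)
    have "blinfun_apply (D (Suc n + k)) v - blinfun_apply (D (Suc n)) v =
        blinfun_apply y (blinfun_apply (D (n + k)) (f v) - blinfun_apply (D n) (f v))"
      by (simp add: D(2) blinfun.bilinear_simps f_def)
    then show ?case
      using Suc[of "f v"] by (simp add: y_iso funpow_swap1)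
  qed (simp add: D(1))
  have g_dec: "decseq (g v)" for v
    unfolding decseq_Suc_iff g_def f_def using norm_blinfun_le_1D[OF x'_norm] by (auto intro: power_mono)
  have "Cauchy (\<lambda>n. blinfun_apply (D n) v)" for v
  proof (rule Cauchy_of_increments[OF g_dec[of v]])
    show "0 \<le> g v n" "0 \<le> (norm a)\<^sup>2" for n
      by (simp_all add: g_def)
    show "(norm (blinfun_apply (D (n + k)) v - blinfun_apply (D n) v))\<^sup>2 \<le> (norm a)\<^sup>2 * (g v n - g v (n + k))" for n k
    proof -
      have "(f ^^ k) ((f ^^ n) v) = (f ^^ (n + k)) v"
        by (metis add.commute comp_apply funpow_add)
      then show ?thesis
        using bound[of k "(f ^^ n) v"] unfolding incr by (simp only: g_def)
    qed
  qed
  then have conv: "convergent (\<lambda>n. blinfun_apply (D n) v)" for v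
    by (rule Cauchy_convergent)
  show D_norm: "norm (D n) \<le> norm a" for n
  proof (rule norm_blinfun_bound)
    fix v
    have "(norm (blinfun_apply (D n) v))\<^sup>2 \<le> (norm a)\<^sup>2 * (norm v)\<^sup>2"
      using bound[of n v] by (rule order_trans) (intro mult_left_mono, auto simp: g_def)
    then have "(norm (blinfun_apply (D n) v))\<^sup>2 \<le> (norm a * norm v)\<^sup>2"
      by (simp add: power_mult_distrib)
    then show "norm (blinfun_apply (D n) v) \<le> norm a * norm v"
      by (rule power2_le_imp_le) simp
  qed simp
  show "\<exists>L. \<forall>v. (\<lambda>n. blinfun_apply (D n) v) \<longlonglongrightarrow> blinfun_apply L v"
    using conv D_norm by (rule ex_strong_limit)
qed

text \<open>The auxiliary \<open>E n\<close> is 1 - x^n (adj x)^n, so \<open>s n\<close> is t x^n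
  (adj x)^n plus the shift series \<open>D n\<close>. In the limit the first term acts as t on the
  unitary part of x. Both \<open>D\<close> and \<open>E\<close> are instances of
  \<open>shift_series_converges\<close>.\<close>

lemma modified_intertwiner_converges:
  assumes x: "x \<in> M" "adj x o\<^sub>L x = id_blinfun" and y: "y \<in> M" "adj y o\<^sub>L y = id_blinfun"
    and t: "t \<in> M" "t o\<^sub>L x = y o\<^sub>L t"
    and a: "a \<in> M" "a o\<^sub>L x = 0" "adj y o\<^sub>L a = 0"
    and s: "s 0 = t" "\<And>n. s (Suc n) = a + (y o\<^sub>L (s n o\<^sub>L adj x))"
  shows "\<exists>S\<in>M. (\<forall>v. (\<lambda>n. blinfun_apply (s n) v) \<longlonglongrightarrow> blinfun_apply S v) \<and> (\<exists>C. \<forall>n. norm (s n) \<le> C)"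
proof -
  define d where "d = id_blinfun - (x o\<^sub>L adj x)"
  have d: "d \<in> M" "d o\<^sub>L x = 0" "adj x o\<^sub>L d = 0"
    using x by (simp_all add: d_def blinfun_compose_bilinear blinfun_compose_assoc
        blinfun_compose_extend[OF x(2)])
  define D where "D = rec_nat 0 (\<lambda>_ B. a + (y o\<^sub>L (B o\<^sub>L adj x)))"
  define E where "E = rec_nat 0 (\<lambda>_ B. d + (x o\<^sub>L (B o\<^sub>L adj x)))"
  have D: "D 0 = 0" "\<And>n. D (Suc n) = a + (y o\<^sub>L (D n o\<^sub>L adj x))"
    by (simp_all add: D_def)
  have E: "E 0 = 0" "\<And>n. E (Suc n) = d + (x o\<^sub>L (E n o\<^sub>L adj x))"
    by (simp_all add: E_def)
  obtain LD where LD: "\<And>v. (\<lambda>n. blinfun_apply (D n) v) \<longlonglongrightarrow> blinfun_apply LD v"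
    using shift_series_converges(1)[OF x y a D] by blast
  obtain LE where LE: "\<And>v. (\<lambda>n. blinfun_apply (E n) v) \<longlonglongrightarrow> blinfun_apply LE v"
    using shift_series_converges(1)[OF x x d E] by blast
  have s_eq: "s n = t - (t o\<^sub>L E n) + D n" for n
  proof (induction n)
    case (Suc n)
    have "s (Suc n) = a + (y o\<^sub>L ((t - (t o\<^sub>L E n) + D n) o\<^sub>L adj x))"
      by (simp add: s(2) Suc)
    \<comment> \<open>By t x = y t, the term \<open>y o\<^sub>L (t o\<^sub>L adj x)\<close> equals t
      - t d.\<close>
    also have "\<dots> = t - (t o\<^sub>L E (Suc n)) + D (Suc n)"
      by (simp add: D(2) E(2) d_def op_simps t(2) blinfun_compose_extend[OF t(2)])
    finally show ?case .
  qed (simp add: s(1) D(1) E(1))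
  let ?S = "t - (t o\<^sub>L LE) + LD"
  have lim: "(\<lambda>n. blinfun_apply (s n) v) \<longlonglongrightarrow> blinfun_apply ?S v" for v
    unfolding s_eq blinfun.add_left blinfun.diff_left blinfun_apply_blinfun_compose
    by (intro tendsto_intros LD LE blinfun.tendsto)
  have "s n \<in> M" for n
    by (induction n) (use x y t a in \<open>auto simp: s\<close>)
  then have "?S \<in> M"
    using lim by (rule strong_limit_in_M)
  moreover have "norm (s n) \<le> norm t + norm t * norm d + norm a" for n
  proof -
    have "norm (t o\<^sub>L E n) \<le> norm t * norm d"
      using norm_blinfun_compose[of t "E n"] shift_series_converges(2)[OF x x d E, of n]
      by (meson mult_left_mono norm_ge_zero order_trans)
    then show ?thesis
      unfolding s_eq using shift_series_converges(2)[OF x y a D, of n]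
        norm_triangle_ineq[of "t - (t o\<^sub>L E n)" "D n"] norm_triangle_ineq4[of t "t o\<^sub>L E n"] by linarith
  qed
  ultimately show ?thesis
    using lim by (intro bexI[of _ ?S]) auto
qed

text \<open>In the product of the two recursions the mixed terms vanish by b y = 0 and
  \<open>adj y o\<^sub>L a = 0\<close>. The term b a supplies the projection onto the complement of
  the range of x, and the induction hypothesis turns the last term into
  \<open>x o\<^sub>L adj x\<close>.\<close>

lemma modified_intertwiner_left_inverse:
  assumes x: "adj x o\<^sub>L x = id_blinfun" and y: "adj y o\<^sub>L y = id_blinfun"
    and a: "b o\<^sub>L a = id_blinfun - (x o\<^sub>L adj x)" "b o\<^sub>L y = 0" "adj y o\<^sub>L a = 0"
    and s: "\<And>n. s (Suc n) = a + (y o\<^sub>L (s n o\<^sub>L adj x))"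
    and p: "\<And>n. p (Suc n) = b + (x o\<^sub>L (p n o\<^sub>L adj y))"
    and ps: "p 0 o\<^sub>L s 0 = id_blinfun"
  shows "p n o\<^sub>L s n = id_blinfun"
proof (induction n)
  case (Suc n)
  then show ?case
    by (simp add: s p op_simps a y blinfun_compose_extend[OF a(2)] blinfun_compose_extend[OF y]
        blinfun_compose_extend[OF Suc])
qed (fact ps)

text \<open>In the Wold decomposition of $x$, the operator constructed here acts as $t$ on the unitary part and
  as $\sum_n y^n (t^{-1})^* (1 - xx^*) x^{*n}$ on the shift part; its inverse is built in the same way from
  $t^{-1}$, and the two sequences of approximations are inverse to each other at every stage.\<close>

lemma ex_double_intertwiner:
  assumes x: "x \<in> M" "adj x o\<^sub>L x = id_blinfun" and y: "y \<in> M" "adj y o\<^sub>L y = id_blinfun"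
    and t: "t \<in> M" "r \<in> M" "r o\<^sub>L t = id_blinfun" "t o\<^sub>L r = id_blinfun" "t o\<^sub>L x = y o\<^sub>L t"
  shows "\<exists>S\<in>M. \<exists>P\<in>M. P o\<^sub>L S = id_blinfun \<and> S o\<^sub>L P = id_blinfun \<and>
    S o\<^sub>L x = y o\<^sub>L S \<and> adj y o\<^sub>L S = S o\<^sub>L adj x"
proof -
  have "r o\<^sub>L y = r o\<^sub>L (y o\<^sub>L (t o\<^sub>L r))"
    using t(4) by simp
  also have "\<dots> = (r o\<^sub>L t) o\<^sub>L (x o\<^sub>L r)"
    using t(5) by (metis blinfun_compose_assoc)
  finally have ry: "r o\<^sub>L y = x o\<^sub>L r"
    using t(3) by simp
  \<comment> \<open>Adjoints of the intertwining relations: \<open>adj r\<close> maps the kernel of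
    \<open>adj x\<close> onto that of \<open>adj y\<close>, with inverse
    \<open>adj t\<close>.\<close>
  have "adj (r o\<^sub>L y) = adj (x o\<^sub>L r)" "adj (t o\<^sub>L x) = adj (y o\<^sub>L t)"
    "adj (r o\<^sub>L t) = id_blinfun" "adj (t o\<^sub>L r) = id_blinfun"
    using ry t by simp_all
  then have adjs: "adj y o\<^sub>L adj r = adj r o\<^sub>L adj x" "adj x o\<^sub>L adj t = adj t o\<^sub>L adj y"
    "adj t o\<^sub>L adj r = id_blinfun" "adj r o\<^sub>L adj t = id_blinfun"
    using x(1) y(1) t(1,2) by simp_all
  note simps = op_simps adjs adjs[THEN blinfun_compose_extend] x(2) y(2)
    x(2)[THEN blinfun_compose_extend] y(2)[THEN blinfun_compose_extend]
  \<comment> \<open>These are \<open>adj r\<close> and \<open>adj t\<close> cut down to the two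
    kernels, so that b a and a b become the projections onto them.\<close>
  define a where "a = adj r o\<^sub>L (id_blinfun - (x o\<^sub>L adj x))"
  define b where "b = adj t o\<^sub>L (id_blinfun - (y o\<^sub>L adj y))"
  have a: "a \<in> M" "a o\<^sub>L x = 0" "adj y o\<^sub>L a = 0"
    using x t by (simp_all add: a_def simps)
  have b: "b \<in> M" "b o\<^sub>L y = 0" "adj x o\<^sub>L b = 0"
    using y t by (simp_all add: b_def simps)
  have "b o\<^sub>L a = adj t o\<^sub>L a"
    using a(3) by (simp add: b_def op_simps)
  then have ba: "b o\<^sub>L a = id_blinfun - (x o\<^sub>L adj x)"
    by (simp add: a_def simps)
  have "a o\<^sub>L b = adj r o\<^sub>L b"
    using b(3) by (simp add: a_def op_simps)
  then have ab: "a o\<^sub>L b = id_blinfun - (y o\<^sub>L adj y)"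
    by (simp add: b_def simps)
  define s where "s = rec_nat t (\<lambda>_ B. a + (y o\<^sub>L (B o\<^sub>L adj x)))"
  define p where "p = rec_nat r (\<lambda>_ B. b + (x o\<^sub>L (B o\<^sub>L adj y)))"
  have s: "s 0 = t" "\<And>n. s (Suc n) = a + (y o\<^sub>L (s n o\<^sub>L adj x))"
    by (simp_all add: s_def)
  have p: "p 0 = r" "\<And>n. p (Suc n) = b + (x o\<^sub>L (p n o\<^sub>L adj y))"
    by (simp_all add: p_def)
  obtain S C where S: "S \<in> M" "\<And>v. (\<lambda>n. blinfun_apply (s n) v) \<longlonglongrightarrow> blinfun_apply S v" "\<And>n. norm (s n) \<le> C"
    using modified_intertwiner_converges[OF x y t(1,5) a s] by blast
  obtain P C' where P: "P \<in> M" "\<And>v. (\<lambda>n. blinfun_apply (p n) v) \<longlonglongrightarrow> blinfun_apply P v" "\<And>n. norm (p n) \<le> C'"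
    using modified_intertwiner_converges[OF y x t(2) ry b p] by blast
  have ps: "p n o\<^sub>L s n = id_blinfun" for n
    by (rule modified_intertwiner_left_inverse[OF x(2) y(2) ba b(2) a(3), of s p]) (simp_all add: s p t)
  have sp: "s n o\<^sub>L p n = id_blinfun" for n
    by (rule modified_intertwiner_left_inverse[OF y(2) x(2) ab a(2) b(3), of p s]) (simp_all add: s p t)
  have PS: "P o\<^sub>L S = id_blinfun" "S o\<^sub>L P = id_blinfun"
    using strong_limit_inverse[OF P(2,3) S(2) ps] strong_limit_inverse[OF S(2,3) P(2) sp] by auto
  \<comment> \<open>Multiplied by x on the right and by \<open>adj y\<close> on the left, this
    equation yields the two intertwining relations, because a x and \<open>adj y o\<^sub>L a\<close>
    vanish.\<close>
  have S_fix: "S = a + (y o\<^sub>L (S o\<^sub>L adj x))"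
  proof (rule blinfun_eqI)
    fix v
    have "(\<lambda>n. blinfun_apply (s (Suc n)) v) \<longlonglongrightarrow> blinfun_apply (a + (y o\<^sub>L (S o\<^sub>L adj x))) v"
      unfolding s(2) blinfun.add_left blinfun_apply_blinfun_compose
      by (intro tendsto_intros S(2) blinfun.tendsto)
    moreover have "(\<lambda>n. blinfun_apply (s (Suc n)) v) \<longlonglongrightarrow> blinfun_apply S v"
      using S(2) by (rule LIMSEQ_Suc)
    ultimately show "blinfun_apply S v = blinfun_apply (a + (y o\<^sub>L (S o\<^sub>L adj x))) v"
      using LIMSEQ_unique by blast
  qed
  have "S o\<^sub>L x = y o\<^sub>L S"
    by (subst S_fix) (simp add: op_simps a x)
  moreover have "adj y o\<^sub>L S = S o\<^sub>L adj x"
    by (subst S_fix) (simp add: op_simps a y blinfun_compose_extend[OF y(2)])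
  ultimately show ?thesis
    using S(1) P(1) PS by blast
qed

text \<open>The second relation has the adjoint
  \<open>adj S o\<^sub>L y = x o\<^sub>L adj S\<close>; with the first it makes
  \<open>adj S o\<^sub>L S\<close> commute with x. So do its square root and its inverse, and the
  polar part of S inherits the intertwining.\<close>

lemma unitary_part_intertwines:
  assumes S: "S \<in> M" "P \<in> M" "P o\<^sub>L S = id_blinfun" "S o\<^sub>L P = id_blinfun"
    and xy: "x \<in> M" "y \<in> M" "S o\<^sub>L x = y o\<^sub>L S" "adj y o\<^sub>L S = S o\<^sub>L adj x"
  shows "\<exists>u. unitary_in M id_blinfun u \<and> u o\<^sub>L x = y o\<^sub>L u"
proof -
  \<comment> \<open>Rescaling reaches the norm bound required by \<open>ex_absolute_value\<close>;
    adding 1 keeps the factor positive even on the zero space.\<close>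
  define c where "c = norm S + 1"
  have c: "c > 0" by (simp add: c_def add_nonneg_pos)
  define T where "T = (1/c) *\<^sub>R S"
  define R where "R = c *\<^sub>R P"
  have TM: "T \<in> M" and RM: "R \<in> M"
    using S by (simp_all add: T_def R_def)
  have RT: "R o\<^sub>L T = id_blinfun" and TR: "T o\<^sub>L R = id_blinfun"
    using S c by (simp_all add: T_def R_def blinfun_compose_bilinear)
  have Tx: "T o\<^sub>L x = y o\<^sub>L T" and yT: "adj y o\<^sub>L T = T o\<^sub>L adj x"
    using xy by (simp_all add: T_def blinfun_compose_bilinear)
  have "norm T \<le> 1"
    using c by (simp add: T_def c_def)
  then obtain g where g: "g \<in> M" "adj g = g" "g o\<^sub>L g = adj T o\<^sub>L T"
    "\<And>C. C o\<^sub>L (adj T o\<^sub>L T) = (adj T o\<^sub>L T) o\<^sub>L C \<Longrightarrow> C o\<^sub>L g = g o\<^sub>L C"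
    using ex_absolute_value[OF TM] by blast
  have "adj (adj y o\<^sub>L T) = adj (T o\<^sub>L adj x)"
    using yT by simp
  then have Ty: "adj T o\<^sub>L y = x o\<^sub>L adj T"
    using xy TM by simp
  have "adj (R o\<^sub>L T) = id_blinfun" "adj (T o\<^sub>L R) = id_blinfun"
    using RT TR by simp_all
  then have RT': "adj T o\<^sub>L adj R = id_blinfun" and TR': "adj R o\<^sub>L adj T = id_blinfun"
    using RM TM by simp_all
  define k where "k = R o\<^sub>L adj R"
  have kM: "k \<in> M" "adj k = k"
    using RM by (simp_all add: k_def)
  note simps = blinfun_compose_assoc RT TR RT' TR' blinfun_compose_extend[OF RT]
    blinfun_compose_extend[OF TR] blinfun_compose_extend[OF RT'] blinfun_compose_extend[OF TR']
  have hk: "(adj T o\<^sub>L T) o\<^sub>L k = id_blinfun" and kh: "k o\<^sub>L (adj T o\<^sub>L T) = id_blinfun"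
    by (simp_all add: k_def simps)
  have xh: "x o\<^sub>L (adj T o\<^sub>L T) = (adj T o\<^sub>L T) o\<^sub>L x"
    using Tx Ty by (metis blinfun_compose_assoc)
  have xg: "x o\<^sub>L g = g o\<^sub>L x"
    using g(4) xh by blast
  have xk: "x o\<^sub>L k = k o\<^sub>L x"
    using inverse_commute[OF kh hk xh] .
  have gk: "g o\<^sub>L k = k o\<^sub>L g"
    by (rule inverse_commute[OF kh hk]) (simp add: g(3)[symmetric] blinfun_compose_assoc)
  have ggk: "g o\<^sub>L (g o\<^sub>L k) = id_blinfun"
    using hk g(3) by (simp flip: blinfun_compose_assoc)
  \<comment> \<open>g is the absolute value of T and k inverts g^2, so g k is the inverse of g and u
    is the polar part of T.\<close>
  define u where "u = T o\<^sub>L (g o\<^sub>L k)"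
  have uM: "u \<in> M"
    using TM g(1) kM by (simp add: u_def)
  have u_adj: "adj u = g o\<^sub>L (k o\<^sub>L adj T)"
  proof -
    have "adj u = (k o\<^sub>L g) o\<^sub>L adj T"
      using TM g(1,2) kM by (simp add: u_def)
    then show ?thesis
      by (metis gk blinfun_compose_assoc)
  qed
  have "adj u o\<^sub>L u = g o\<^sub>L (k o\<^sub>L (adj T o\<^sub>L T)) o\<^sub>L (g o\<^sub>L k)"
    unfolding u_adj by (simp add: u_def blinfun_compose_assoc)
  then have "adj u o\<^sub>L u = id_blinfun"
    by (simp add: kh ggk)
  moreover have "u o\<^sub>L adj u = T o\<^sub>L (g o\<^sub>L (k o\<^sub>L g)) o\<^sub>L (k o\<^sub>L adj T)"
    unfolding u_adj by (simp add: u_def blinfun_compose_assoc)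
  then have "u o\<^sub>L adj u = id_blinfun"
    unfolding ggk[unfolded gk] by (simp add: k_def simps)
  moreover have "u o\<^sub>L x = y o\<^sub>L u"
  proof -
    have "u o\<^sub>L x = T o\<^sub>L (x o\<^sub>L (g o\<^sub>L k))"
      by (simp add: u_def blinfun_compose_assoc xk[symmetric] blinfun_compose_extend[OF xg])
    also have "\<dots> = y o\<^sub>L u"
      by (simp add: u_def blinfun_compose_extend[OF Tx] blinfun_compose_assoc)
    finally show ?thesis .
  qed
  ultimately show ?thesis
    using uM by (auto simp: unitary_in_def)
qed

section \<open>Elements of the stated form are extreme\<close>

text \<open>Polarisation, in the form of \<open>dot_norm\<close>, recovers inner products from
  norms.\<close>

lemma isometry_of_norm:
  assumes "y \<in> M" "\<And>v. norm (blinfun_apply y v) = norm v"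
  shows "adj y o\<^sub>L y = id_blinfun"
proof (rule blinfun_eqI, rule inner_eqI)
  fix v w
  have "inner (blinfun_apply (adj y o\<^sub>L y) v) w = inner (blinfun_apply y v) (blinfun_apply y w)"
    using assms(1) by (simp add: inner_adj_left)
  also have "\<dots> = inner v w"
    by (simp add: dot_norm assms(2) flip: blinfun.add_right)
  finally show "inner (blinfun_apply (adj y o\<^sub>L y) v) w = inner (blinfun_apply id_blinfun v) w"
    by simp
qed

text \<open>The columns with entries t_j x v and y_j t_j v are compared. The first has squared
  length |x v|^2 = |v|^2, the second at most |v|^2, and their inner product is that of x v with
  itself, again |v|^2. So the columns coincide.\<close>

lemma isometry_combination:
  assumes x: "x \<in> M" "adj x o\<^sub>L x = id_blinfun" and I: "finite I"
    and y: "\<And>i. i \<in> I \<Longrightarrow> y i \<in> unit_ball M"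
    and t: "\<And>i. i \<in> I \<Longrightarrow> invertible_in M id_blinfun (t i)"
    and one: "(\<Sum>i\<in>I. adj (t i) o\<^sub>L t i) = id_blinfun"
    and sum: "x = (\<Sum>i\<in>I. adj (t i) o\<^sub>L y i o\<^sub>L t i)"
    and i: "i \<in> I"
  shows "\<exists>u. unitary_in M id_blinfun u \<and> y i = adj u o\<^sub>L x o\<^sub>L u"
proof -
  have yM: "y j \<in> M" "norm (y j) \<le> 1" and tM: "t j \<in> M" if "j \<in> I" for j
    using y[OF that] t[OF that] by (auto simp: unit_ball_def invertible_in_def)
  have x_iso: "norm (blinfun_apply x v) = norm v" for v
    using isometry_norm[of x] x by simp
  let ?y = "\<lambda>j v. blinfun_apply (y j) (blinfun_apply (t j) v)"
  have one': "(\<Sum>j\<in>I. (norm (blinfun_apply (t j) v))\<^sup>2) = (norm v)\<^sup>2" for v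
  proof -
    have "(\<Sum>j\<in>I. (norm (blinfun_apply (t j) v))\<^sup>2) = (\<Sum>j\<in>I. inner v (blinfun_apply (adj (t j) o\<^sub>L t j) v))"
      using tM by (intro sum.cong refl norm_adj_compose) simp
    also have "\<dots> = inner v (blinfun_apply (\<Sum>j\<in>I. adj (t j) o\<^sub>L t j) v)"
      by (simp add: blinfun.sum_left inner_sum_right)
    finally show ?thesis
      by (simp add: one power2_norm_eq_inner)
  qed
  have cross: "(\<Sum>j\<in>I. inner (blinfun_apply (t j) (blinfun_apply x v)) (?y j v)) = (norm v)\<^sup>2" for v
  proof -
    have "(\<Sum>j\<in>I. inner (blinfun_apply (t j) (blinfun_apply x v)) (?y j v)) =
        (\<Sum>j\<in>I. inner (blinfun_apply x v) (blinfun_apply (adj (t j) o\<^sub>L y j o\<^sub>L t j) v))"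
      using tM by (intro sum.cong refl) (simp add: inner_adj_right)
    also have "\<dots> = inner (blinfun_apply x v) (blinfun_apply (\<Sum>j\<in>I. adj (t j) o\<^sub>L y j o\<^sub>L t j) v)"
      by (simp add: blinfun.sum_left inner_sum_right)
    finally show ?thesis
      by (simp flip: sum power2_norm_eq_inner add: x_iso)
  qed
  have y_le: "(norm (?y j v))\<^sup>2 \<le> (norm (blinfun_apply (t j) v))\<^sup>2" if "j \<in> I" for j v
    using yM(2)[OF that] by (intro power_mono norm_blinfun_le_1D) auto
  have y_sum_le: "(\<Sum>j\<in>I. (norm (?y j v))\<^sup>2) \<le> (norm v)\<^sup>2" for v
    unfolding one'[of v, symmetric] by (intro sum_mono y_le)
  have sq: "(\<Sum>j\<in>I. (norm (blinfun_apply (t j) (blinfun_apply x v) - ?y j v))\<^sup>2) =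
      (norm v)\<^sup>2 - 2 * (norm v)\<^sup>2 + (\<Sum>j\<in>I. (norm (?y j v))\<^sup>2)" for v
  proof -
    have "(norm (a - b))\<^sup>2 = (norm a)\<^sup>2 - 2 * inner a b + (norm b)\<^sup>2" for a b :: 'h
      by (simp add: power2_norm_eq_inner inner_diff inner_commute)
    then have "(\<Sum>j\<in>I. (norm (blinfun_apply (t j) (blinfun_apply x v) - ?y j v))\<^sup>2) =
        (\<Sum>j\<in>I. (norm (blinfun_apply (t j) (blinfun_apply x v)))\<^sup>2)
        - 2 * (\<Sum>j\<in>I. inner (blinfun_apply (t j) (blinfun_apply x v)) (?y j v)) + (\<Sum>j\<in>I. (norm (?y j v))\<^sup>2)"
      by (simp add: sum.distrib sum_subtractf sum_distrib_left)
    then show ?thesis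
      by (simp only: one' cross x_iso)
  qed
  have "(\<Sum>j\<in>I. (norm (blinfun_apply (t j) (blinfun_apply x v) - ?y j v))\<^sup>2) = 0" for v
  proof (rule antisym)
    show "(\<Sum>j\<in>I. (norm (blinfun_apply (t j) (blinfun_apply x v) - ?y j v))\<^sup>2) \<le> 0"
      unfolding sq using y_sum_le[of v] by linarith
  qed (simp add: sum_nonneg)
  \<comment> \<open>A vanishing left side of \<open>sq\<close> gives the second column full length
    as well. Compared entrywise with \<open>one'\<close>, this makes each y_j preserve the norm of
    t_j v.\<close>
  then have zero: "\<forall>j\<in>I. (norm (blinfun_apply (t j) (blinfun_apply x v) - ?y j v))\<^sup>2 = 0"
    and y_sum: "(\<Sum>j\<in>I. (norm (?y j v))\<^sup>2) = (norm v)\<^sup>2" for v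
    using I sum_nonneg_eq_0_iff[of I "\<lambda>j. (norm (blinfun_apply (t j) (blinfun_apply x v) - ?y j v))\<^sup>2"]
      sq[of v] by auto
  have inter: "t i o\<^sub>L x = y i o\<^sub>L t i"
    by (rule blinfun_eqI) (use zero i in auto)
  have "(\<Sum>j\<in>I. (norm (blinfun_apply (t j) v))\<^sup>2 - (norm (?y j v))\<^sup>2) = 0" for v
    by (simp add: sum_subtractf one' y_sum)
  then have "(norm (blinfun_apply (t i) v))\<^sup>2 - (norm (?y i v))\<^sup>2 = 0" for v
    using sum_nonneg_eq_0_iff[OF I, of "\<lambda>j. (norm (blinfun_apply (t j) v))\<^sup>2 - (norm (?y j v))\<^sup>2"] y_le i
    by simp
  then have y_norm: "norm (?y i v) = norm (blinfun_apply (t i) v)" for v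
    by simp
  obtain r where r: "r \<in> M" "r o\<^sub>L t i = id_blinfun" "t i o\<^sub>L r = id_blinfun"
    using t[OF i] by (auto simp: invertible_in_def)
  \<comment> \<open>Every v is t_i applied to r v, so norm preservation extends from the range of
    t_i to the whole space.\<close>
  have "norm (blinfun_apply (y i) v) = norm v" for v
    using y_norm[of "blinfun_apply r v"] arg_cong[OF r(3), of "\<lambda>B. blinfun_apply B v"] by simp
  then have y_iso: "adj (y i) o\<^sub>L y i = id_blinfun"
    using yM[OF i] by (intro isometry_of_norm)
  obtain S P where "S \<in> M" "P \<in> M" "P o\<^sub>L S = id_blinfun" "S o\<^sub>L P = id_blinfun"
    "S o\<^sub>L x = y i o\<^sub>L S" "adj (y i) o\<^sub>L S = S o\<^sub>L adj x"
    using ex_double_intertwiner[OF x yM(1)[OF i] y_iso tM[OF i] r inter] by blast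
  then obtain u where u: "unitary_in M id_blinfun u" "u o\<^sub>L x = y i o\<^sub>L u"
    using unitary_part_intertwines x(1) yM(1)[OF i] by meson
  have uM: "u \<in> M" and uu: "adj u o\<^sub>L u = id_blinfun" "u o\<^sub>L adj u = id_blinfun"
    using u(1) by (auto simp: unitary_in_def)
  \<comment> \<open>From u x = y_i u, the unitary in the required form is \<open>adj u\<close>, not
    u.\<close>
  have "y i = y i o\<^sub>L (u o\<^sub>L adj u)"
    using uu by simp
  also have "\<dots> = u o\<^sub>L x o\<^sub>L adj u"
    using u(2) by (metis blinfun_compose_assoc)
  finally have "y i = adj (adj u) o\<^sub>L x o\<^sub>L adj u"
    using uM by simp
  moreover have "unitary_in M id_blinfun (adj u)"
    using uM uu by (simp add: unitary_in_def)
  ultimately show ?thesis by blast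
qed

text \<open>Adding q = 1 - z to z x and to each z y_j, with the same t_j, produces a combination in
  M representing a genuine isometry: the q parts agree because the weights sum to 1. Multiplication
  by z removes q from the resulting conjugacy.\<close>

lemma corner_isometry_combination:
  assumes z: "central_projection M z" and x: "x \<in> M" "z o\<^sub>L (adj x o\<^sub>L x) = z" and I: "finite I"
    and y: "\<And>i. i \<in> I \<Longrightarrow> y i \<in> unit_ball M"
    and t: "\<And>i. i \<in> I \<Longrightarrow> invertible_in M id_blinfun (t i)"
    and one: "(\<Sum>i\<in>I. adj (t i) o\<^sub>L t i) = id_blinfun"
    and sum: "x = (\<Sum>i\<in>I. adj (t i) o\<^sub>L y i o\<^sub>L t i)"
    and i: "i \<in> I"
  shows "\<exists>u. unitary_in M id_blinfun u \<and> z o\<^sub>L y i = z o\<^sub>L (adj u o\<^sub>L x o\<^sub>L u)"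
proof -
  have zM: "z \<in> M" "adj z = z" "z o\<^sub>L z = z" and zc: "\<And>w. w \<in> M \<Longrightarrow> z o\<^sub>L w = w o\<^sub>L z"
    using z by (auto simp: central_projection_def)
  have yM: "y j \<in> M" "norm (y j) \<le> 1" and tM: "t j \<in> M" if "j \<in> I" for j
    using y[OF that] t[OF that] by (auto simp: unit_ball_def invertible_in_def)
  define q where "q = id_blinfun - z"
  have qM: "q \<in> M" "adj q = q" and qc: "w o\<^sub>L q = q o\<^sub>L w" if "w \<in> M" for w
    using zM zc[OF that] by (simp_all add: q_def blinfun_compose_bilinear)
  have zq: "z o\<^sub>L q = 0" "q o\<^sub>L z = 0" "q o\<^sub>L q = q"
    using zM by (simp_all add: q_def blinfun_compose_bilinear)
  define X where "X = (z o\<^sub>L x) + q"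
  define Y where "Y = (\<lambda>j. (z o\<^sub>L y j) + q)"
  have XM: "X \<in> M"
    using zM(1) qM(1)[OF M_id] x(1) by (simp add: X_def)
  note comm = zc[OF x(1), symmetric] zc[OF x(1), symmetric, THEN blinfun_compose_extend]
    zc[OF M_closed(3)[OF x(1)], symmetric] zc[OF M_closed(3)[OF x(1)], symmetric, THEN blinfun_compose_extend]
    qc[OF x(1)] qc[OF x(1), THEN blinfun_compose_extend]
    qc[OF M_closed(3)[OF x(1)]] qc[OF M_closed(3)[OF x(1)], THEN blinfun_compose_extend]
    zM(3) zM(3)[THEN blinfun_compose_extend] zq zq[THEN blinfun_compose_extend]
  have "adj X = (z o\<^sub>L adj x) + q"
    using zM qM[OF M_id] x(1) by (simp add: X_def comm)
  then have "adj X o\<^sub>L X = (z o\<^sub>L (adj x o\<^sub>L x)) + q"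
    by (simp add: X_def op_simps comm)
  then have X_iso: "adj X o\<^sub>L X = id_blinfun"
    by (simp add: x(2) q_def)
  have Y_ball: "Y j \<in> unit_ball M" if j: "j \<in> I" for j
  proof -
    have pyth: "(norm (blinfun_apply z v + blinfun_apply q w))\<^sup>2 = (norm (blinfun_apply z v))\<^sup>2 + (norm (blinfun_apply q w))\<^sup>2" for v w
    proof -
      have "inner (blinfun_apply z v) (blinfun_apply q w) = inner v (blinfun_apply (z o\<^sub>L q) w)"
        using inner_adj_right[of z v "blinfun_apply q w"] zM by simp
      then show ?thesis
        by (simp add: zq power2_norm_eq_inner inner_add inner_commute)
    qed
    have "norm (Y j) \<le> 1"
    proof (rule norm_blinfun_bound)
      fix v
      have "(norm (blinfun_apply (Y j) v))\<^sup>2 = (norm (blinfun_apply z (blinfun_apply (y j) v)))\<^sup>2 + (norm (blinfun_apply q v))\<^sup>2"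
        using pyth[of "blinfun_apply (y j) v" v] by (simp add: Y_def blinfun.bilinear_simps)
      also have "blinfun_apply z (blinfun_apply (y j) v) = blinfun_apply (y j) (blinfun_apply z v)"
        using zc[OF yM(1)[OF j]] by (simp flip: blinfun_apply_blinfun_compose)
      also have "(norm (blinfun_apply (y j) (blinfun_apply z v)))\<^sup>2 + (norm (blinfun_apply q v))\<^sup>2 \<le>
          (norm (blinfun_apply z v))\<^sup>2 + (norm (blinfun_apply q v))\<^sup>2"
        by (intro add_right_mono power_mono norm_blinfun_le_1D yM(2)[OF j]) simp
      also have "\<dots> = (norm v)\<^sup>2"
        unfolding pyth[symmetric] by (simp add: q_def blinfun.bilinear_simps)
      finally show "norm (blinfun_apply (Y j) v) \<le> 1 * norm v"
        by simp
    qed simp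
    then show ?thesis
      using zM(1) qM(1)[OF M_id] yM(1)[OF j] by (simp add: Y_def unit_ball_def)
  qed
  have "adj (t j) o\<^sub>L Y j o\<^sub>L t j = (z o\<^sub>L (adj (t j) o\<^sub>L y j o\<^sub>L t j)) + (q o\<^sub>L (adj (t j) o\<^sub>L t j))"
    if j: "j \<in> I" for j
  proof -
    have tj: "adj (t j) \<in> M" using tM[OF j] by simp
    show ?thesis
      by (simp add: Y_def op_simps blinfun_compose_extend[OF zc[OF tj, symmetric]]
          blinfun_compose_extend[OF qc[OF tj]])
  qed
  then have "(\<Sum>j\<in>I. adj (t j) o\<^sub>L Y j o\<^sub>L t j) =
      (\<Sum>j\<in>I. (z o\<^sub>L (adj (t j) o\<^sub>L y j o\<^sub>L t j)) + (q o\<^sub>L (adj (t j) o\<^sub>L t j)))"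
    by (intro sum.cong refl)
  also have "\<dots> = (z o\<^sub>L (\<Sum>j\<in>I. adj (t j) o\<^sub>L y j o\<^sub>L t j)) + (q o\<^sub>L (\<Sum>j\<in>I. adj (t j) o\<^sub>L t j))"
    by (simp add: sum.distrib bounded_bilinear.sum_right[OF bounded_bilinear_blinfun_compose])
  finally have "X = (\<Sum>j\<in>I. adj (t j) o\<^sub>L Y j o\<^sub>L t j)"
    by (simp add: one X_def flip: sum)
  then obtain u where u: "unitary_in M id_blinfun u" "Y i = adj u o\<^sub>L X o\<^sub>L u"
    using isometry_combination[OF XM X_iso I, of Y t i] Y_ball t one i by blast
  have "adj u \<in> M"
    using u(1) by (simp add: unitary_in_def)
  have "z o\<^sub>L Y i = z o\<^sub>L y i"
    by (simp add: Y_def op_simps zM(3)[THEN blinfun_compose_extend] zq)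
  moreover have "z o\<^sub>L (adj u o\<^sub>L X o\<^sub>L u) = adj u o\<^sub>L ((z o\<^sub>L X) o\<^sub>L u)"
    using zc[OF \<open>adj u \<in> M\<close>] by (metis blinfun_compose_assoc)
  moreover have "z o\<^sub>L X = z o\<^sub>L x"
    by (simp add: X_def op_simps zM(3)[THEN blinfun_compose_extend] zq)
  ultimately have "z o\<^sub>L y i = adj u o\<^sub>L ((z o\<^sub>L x) o\<^sub>L u)"
    using u(2) by metis
  also have "\<dots> = z o\<^sub>L (adj u o\<^sub>L x o\<^sub>L u)"
    using zc[OF \<open>adj u \<in> M\<close>] by (metis blinfun_compose_assoc)
  finally show ?thesis
    using u(1) by blast
qed

section \<open>Gluing over complementary central projections\<close>

lemma adj_sum:
  assumes "\<And>i. i \<in> I \<Longrightarrow> T i \<in> M"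
  shows "adj (\<Sum>i\<in>I. T i) = (\<Sum>i\<in>I. adj (T i))"
proof -
  have "adj 0 = (0 :: 'h \<Rightarrow>\<^sub>L 'h)"
    using adj_M(5)[OF M_id, of 0] by simp
  then show ?thesis
    using assms by (induction I rule: infinite_finite_induct) (auto simp: M_sum)
qed

text \<open>Over z the isometric case gives a unitary v. Over q = 1 - z the isometric case is
  applied to \<open>adj x\<close>, which is the combination of the elements \<open>adj (y i)\<close>
  with the same weights, and gives w. By centrality z v + q w is unitary and conjugates x into y_i
  over both pieces.\<close>

lemma central_decomposition_imp_cstar_extreme:
  assumes xB: "x \<in> unit_ball M" and z: "central_projection M z" and xz: "z o\<^sub>L (adj x o\<^sub>L x) = z"
    and xq: "(id_blinfun - z) o\<^sub>L (x o\<^sub>L adj x) = id_blinfun - z"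
  shows "cstar_extreme_point M x"
  unfolding cstar_extreme_point_def
proof (intro conjI allI impI, goal_cases)
  case 1
  show ?case by (fact xB)
next
  case (2 k y t)
  then have y: "\<And>i. i \<in> {1..k} \<Longrightarrow> y i \<in> unit_ball M"
    and t: "\<And>i. i \<in> {1..k} \<Longrightarrow> invertible_in M id_blinfun (t i)"
    and one: "(\<Sum>i\<in>{1..k}. adj (t i) o\<^sub>L t i) = id_blinfun"
    and sum: "x = (\<Sum>i\<in>{1..k}. adj (t i) o\<^sub>L y i o\<^sub>L t i)"
    by blast+
  have yM: "y i \<in> M" "norm (y i) \<le> 1" and tM: "t i \<in> M" if "i \<in> {1..k}" for i
    using y[OF that] t[OF that] by (auto simp: unit_ball_def invertible_in_def)
  have xM: "x \<in> M"
    using xB by (simp add: unit_ball_def)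
  define q where "q = id_blinfun - z"
  have zp: "z \<in> M" "adj z = z" "z o\<^sub>L z = z" and zc: "\<And>w. w \<in> M \<Longrightarrow> z o\<^sub>L w = w o\<^sub>L z"
    using z by (auto simp: central_projection_def)
  have q: "central_projection M q"
    unfolding q_def by (rule central_projection_complement[OF z])
  have qp: "q \<in> M" "adj q = q" "q o\<^sub>L q = q" and qc: "\<And>w. w \<in> M \<Longrightarrow> q o\<^sub>L w = w o\<^sub>L q"
    using q by (auto simp: central_projection_def)
  have zq: "z o\<^sub>L q = 0" "q o\<^sub>L z = 0" "z + q = id_blinfun"
    using zp by (simp_all add: q_def blinfun_compose_bilinear)
  have "\<exists>u. unitary_in M id_blinfun u \<and> y i = adj u o\<^sub>L x o\<^sub>L u" if i: "i \<in> {1..k}" for i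
  proof -
    obtain v where v: "unitary_in M id_blinfun v" "z o\<^sub>L y i = z o\<^sub>L (adj v o\<^sub>L x o\<^sub>L v)"
      using corner_isometry_combination[OF z xM xz, of "{1..k}" y t i] y t one sum i by auto
    have "adj x = (\<Sum>i\<in>{1..k}. adj (adj (t i) o\<^sub>L y i o\<^sub>L t i))"
      using tM yM(1) by (subst sum, subst adj_sum) auto
    then have sum': "adj x = (\<Sum>i\<in>{1..k}. adj (t i) o\<^sub>L adj (y i) o\<^sub>L t i)"
      using tM yM(1) by (simp add: blinfun_compose_assoc)
    have x': "adj x \<in> M" "q o\<^sub>L (adj (adj x) o\<^sub>L adj x) = q"
      using xM xq by (simp_all add: q_def)
    have "adj (y i) \<in> unit_ball M" if "i \<in> {1..k}" for i
      using yM[OF that] norm_adj_le[of "y i"] by (simp add: unit_ball_def)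
    then obtain w where w: "unitary_in M id_blinfun w" "q o\<^sub>L adj (y i) = q o\<^sub>L (adj w o\<^sub>L adj x o\<^sub>L w)"
      using corner_isometry_combination[OF q x', of "{1..k}" "\<lambda>i. adj (y i)" t i] t one sum' i by blast
    have vM: "v \<in> M" and vv: "adj v o\<^sub>L v = id_blinfun" "v o\<^sub>L adj v = id_blinfun"
      and wM: "w \<in> M" and ww: "adj w o\<^sub>L w = id_blinfun" "w o\<^sub>L adj w = id_blinfun"
      using v(1) w(1) by (auto simp: unitary_in_def)
    have "adj (q o\<^sub>L adj (y i)) = adj (q o\<^sub>L (adj w o\<^sub>L adj x o\<^sub>L w))"
      using w(2) by simp
    then have "y i o\<^sub>L q = (adj w o\<^sub>L x o\<^sub>L w) o\<^sub>L q"
      using yM(1)[OF i] xM wM qp(1,2) by (simp add: blinfun_compose_assoc)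
    then have qy: "q o\<^sub>L y i = q o\<^sub>L (adj w o\<^sub>L x o\<^sub>L w)"
      using qc[OF yM(1)[OF i]] qc[of "adj w o\<^sub>L x o\<^sub>L w"] xM wM by simp
    have vM': "adj v \<in> M" and wM': "adj w \<in> M"
      using vM wM by simp_all
    note moves = zc[OF vM, symmetric] zc[OF wM, symmetric] zc[OF vM', symmetric] zc[OF wM', symmetric]
      zc[OF xM, symmetric] qc[OF vM, symmetric] qc[OF wM, symmetric] qc[OF vM', symmetric]
      qc[OF wM', symmetric] qc[OF xM, symmetric] zp(3) qp(3) zq(1,2)
    define u where "u = (z o\<^sub>L v) + (q o\<^sub>L w)"
    have uM: "u \<in> M"
      using zp(1) qp(1) vM wM by (simp add: u_def)
    have u_adj: "adj u = (z o\<^sub>L adj v) + (q o\<^sub>L adj w)"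
      using zp(1,2) qp(1,2) vM wM by (simp add: u_def moves)
    have "adj u o\<^sub>L u = id_blinfun" "u o\<^sub>L adj u = id_blinfun"
      unfolding u_adj
      by (simp_all add: u_def op_simps moves moves[THEN blinfun_compose_extend] vv ww zq(3))
    moreover have "adj u o\<^sub>L x o\<^sub>L u = (z o\<^sub>L (adj v o\<^sub>L x o\<^sub>L v)) + (q o\<^sub>L (adj w o\<^sub>L x o\<^sub>L w))"
      unfolding u_adj by (simp add: u_def op_simps moves moves[THEN blinfun_compose_extend])
    then have "adj u o\<^sub>L x o\<^sub>L u = (z + q) o\<^sub>L y i"
      by (simp add: v(2) qy blinfun_compose_bilinear)
    ultimately show ?thesis
      using uM by (auto simp: unitary_in_def zq(3))
  qed
  then show ?case by metis
qed

text \<open>Of z and q = 1 - z, each piece over which x is unitary goes into p1. This includes a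
  zero piece, over which x is trivially unitary. Conversely, p1 + p2 = 1 - p3 serves as z.\<close>

lemma central_decomposition_iff:
  "(\<exists>z. central_projection M z \<and> z o\<^sub>L (adj x o\<^sub>L x) = z \<and>
      (id_blinfun - z) o\<^sub>L (x o\<^sub>L adj x) = id_blinfun - z) \<longleftrightarrow>
    (\<exists>p1 p2 p3. central_projection M p1 \<and> central_projection M p2 \<and> central_projection M p3 \<and>
      p1 + p2 + p3 = id_blinfun \<and>
      (p1 = 0 \<or> unitary_in (corner p1 M) p1 (p1 o\<^sub>L x)) \<and>
      (p2 = 0 \<or> isometry_in (corner p2 M) p2 (p2 o\<^sub>L x) \<and>
                 \<not> unitary_in (corner p2 M) p2 (p2 o\<^sub>L x)) \<and>
      (p3 = 0 \<or> coisometry_in (corner p3 M) p3 (p3 o\<^sub>L x) \<and>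
                 \<not> unitary_in (corner p3 M) p3 (p3 o\<^sub>L x)))"
  (is "?L \<longleftrightarrow> ?R") if x: "x \<in> M"
proof
  assume ?L
  then obtain z where z: "central_projection M z" "z o\<^sub>L (adj x o\<^sub>L x) = z"
    and xq: "(id_blinfun - z) o\<^sub>L (x o\<^sub>L adj x) = id_blinfun - z" by blast
  define q where "q = id_blinfun - z"
  have q: "central_projection M q" "q o\<^sub>L (x o\<^sub>L adj x) = q" "z + q = id_blinfun"
    using central_projection_complement[OF z(1)] xq by (simp_all add: q_def)
  have zero: "central_projection M 0"
    using adj_M(5)[OF M_id, of 0] by (simp add: central_projection_def)
  have one: "central_projection M id_blinfun"
    by (simp add: central_projection_def)
  let ?U = "\<lambda>p. unitary_in (corner p M) p (p o\<^sub>L x)"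
  have iso: "isometry_in (corner z M) z (z o\<^sub>L x)" and coiso: "coisometry_in (corner q M) q (q o\<^sub>L x)"
    using z q x by (simp_all add: corner_iff)
  consider "?U z" "?U q" | "?U z" "\<not> ?U q" | "\<not> ?U z" "?U q" | "\<not> ?U z" "\<not> ?U q" by blast
  then show ?R
  proof cases
    case 1
    then have "(z + q) o\<^sub>L (adj x o\<^sub>L x) = z + q" "(z + q) o\<^sub>L (x o\<^sub>L adj x) = z + q"
      using z(1) q(1) x by (simp_all add: corner_iff(3) blinfun_compose_bilinear)
    then have "?U id_blinfun"
      unfolding corner_iff(3)[OF one x] q(3) by blast
    then show ?thesis
      using one zero by (intro exI[of _ id_blinfun] exI[of _ 0]) simp
  next
    case 2
    then show ?thesis
      using z(1) q zero coiso by (intro exI[of _ z] exI[of _ 0] exI[of _ q]) simp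
  next
    case 3
    then show ?thesis
      using z(1) q zero iso by (intro exI[of _ q] exI[of _ z] exI[of _ 0]) (simp add: add.commute)
  next
    case 4
    then show ?thesis
      using z(1) q zero iso coiso by (intro exI[of _ 0] exI[of _ z] exI[of _ q]) simp
  qed
next
  assume ?R
  then obtain p1 p2 p3 where p: "central_projection M p1" "central_projection M p2" "central_projection M p3"
    and sum: "p1 + p2 + p3 = id_blinfun"
    and props: "p1 = 0 \<or> unitary_in (corner p1 M) p1 (p1 o\<^sub>L x)"
      "p2 = 0 \<or> isometry_in (corner p2 M) p2 (p2 o\<^sub>L x)"
      "p3 = 0 \<or> coisometry_in (corner p3 M) p3 (p3 o\<^sub>L x)" by blast
  have "p1 o\<^sub>L (adj x o\<^sub>L x) = p1" "p2 o\<^sub>L (adj x o\<^sub>L x) = p2" and p3: "p3 o\<^sub>L (x o\<^sub>L adj x) = p3"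
    using props p x by (auto simp: corner_iff)
  then have "(p1 + p2) o\<^sub>L (adj x o\<^sub>L x) = p1 + p2"
    by (simp add: blinfun_compose_bilinear)
  moreover have eq: "p1 + p2 = id_blinfun - p3"
    using sum by (simp add: eq_diff_eq)
  ultimately show ?L
    using central_projection_complement[OF p(3)] p3 by (intro exI[of _ "p1 + p2"]) simp
qed

end

theorem theorem1:
  fixes M :: "('h::complex_hilbert_space \<Rightarrow>\<^sub>L 'h) set"
    and x :: "'h \<Rightarrow>\<^sub>L 'h"
  assumes "von_neumann_algebra M"
    and "x \<in> unit_ball M"
  shows "cstar_extreme_point M x \<longleftrightarrow>
    (\<exists>p1 p2 p3. central_projection M p1 \<and> central_projection M p2 \<and> central_projection M p3 \<and>
      p1 + p2 + p3 = id_blinfun \<and>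
      (p1 = 0 \<or> unitary_in (corner p1 M) p1 (p1 o\<^sub>L x)) \<and>
      (p2 = 0 \<or> isometry_in (corner p2 M) p2 (p2 o\<^sub>L x) \<and>
                 \<not> unitary_in (corner p2 M) p2 (p2 o\<^sub>L x)) \<and>
      (p3 = 0 \<or> coisometry_in (corner p3 M) p3 (p3 o\<^sub>L x) \<and>
                 \<not> unitary_in (corner p3 M) p3 (p3 o\<^sub>L x)))"
proof -
  interpret vna M by (rule vna.intro) (fact assms(1))
  have "x \<in> M"
    using assms(2) by (simp add: unit_ball_def)
  show ?thesis
    unfolding central_decomposition_iff[OF \<open>x \<in> M\<close>, symmetric]
    using cstar_extreme_imp_central_decomposition central_decomposition_imp_cstar_extreme[OF assms(2)]
    by blast
qed

end
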